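(* Let $p$ be an odd prime and $n$ a positive integer. Then $$S_{np+1}\equiv\begin{cases}(4+12n-9n^2)S_n\pmod{p^3} & \text{if } p=3,\\ 4(np+1)S_n+32n^2S_{n-1}(-1)^{\frac{p-1}{2}}(E_{p-3}-1)p^2\pmod{p^3} & \text{if } p>3.\end{cases}$$
   Context: $(S_n)_{n\ge0}$ is the integer sequence defined by $S_0=1$, $S_1=4$ and $(n+1)^2S_{n+1}=4(3n^2+3n+1)S_n-32n^2S_{n-1}$ for $n\ge1$; equivalently $S_n=\sum_{k=0}^n\binom nk\binom{2k}k\binom{2n-2k}{n-k}$. The Euler numbers $E_n$ are defined by $E_0=1$, $E_{2n-1}=0$ and $\sum_{k=0}^n\binom{2n}{2k}E_{2k}=0$ for $n\ge1$. *)

theory Defs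
  imports Main "HOL-Number_Theory.Number_Theory"
begin

definition S :: "nat \<Rightarrow> int" where
  "S n = (\<Sum>k=0..n. int (n choose k) * int ((2*k) choose k) * int ((2*n-2*k) choose (n-k)))"

function euler_even :: "nat \<Rightarrow> int" where
  "euler_even m = (if m = 0 then 1
     else - (\<Sum>k<m. int ((2*m) choose (2*k)) * euler_even k))"
  by auto
termination by (relation "measure id") auto

definition E :: "nat \<Rightarrow> int" where
  "E n = (if odd n then 0 else euler_even (n div 2))"

end

theory Submission
  imports Defs
begin

text \<open>The recurrence expresses \<open>S (pn+1)\<close> modulo \<open>p\<^sup>3\<close> through \<open>S (pn)\<close> modulo \<open>p\<^sup>3\<close> and
  \<open>S (pn-1)\<close> modulo \<open>p\<close>; the latter is \<open>\<plusminus> S (n-1)\<close> by Lucas' theorem. In the sum for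
  \<open>S (pn)\<close>, the indices divisible by \<open>p\<close> contribute \<open>S n\<close> for \<open>p > 3\<close> by the Wolstenholme-Ljunggren
  congruence (with a correction term for \<open>p = 3\<close>). Every other summand is divisible by \<open>p\<^sup>2\<close>:
  at \<open>k = pj + r\<close> with \<open>0 < 2r < p\<close> it is \<open>p\<^sup>2 (-1)\<^sup>r (n-j)\<^sup>2 / r\<^sup>2\<close> times the \<open>j\<close>-th summand of
  \<open>S n\<close>. The second moment of the summands gives \<open>2n\<^sup>2 S (n-1)\<close>, and the remaining alternating
  sum of \<open>1/r\<^sup>2 = r\<^bsup>p-3\<^esup>\<close> is \<open>\<plusminus> 2 E (p-3)\<close> modulo \<open>p\<close>.\<close>

subsection \<open>Moments and the recurrence\<close>

text \<open>The last factor is written as a central binomial coefficient at \<open>n - k\<close>, so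
  that replacing \<open>k\<close> by \<open>n - k\<close> merely swaps the two central
  factors.\<close>

definition S_term :: "nat \<Rightarrow> nat \<Rightarrow> int" where
  "S_term n k = int (n choose k) * int ((2*k) choose k) * int ((2*(n-k)) choose (n-k))"

lemma S_eq_sum_S_term: "S n = (\<Sum>k\<le>n. S_term n k)"
  unfolding S_def S_term_def by (simp add: atLeast0AtMost diff_mult_distrib2)

lemma S_term_reflect: "k \<le> n \<Longrightarrow> S_term n (n - k) = S_term n k"
  unfolding S_term_def by (simp add: binomial_symmetric [of k n])

lemma sum_S_term_reflect:
  "(\<Sum>k\<le>n. f (n - k) * S_term n k) = (\<Sum>k\<le>n. f k * S_term n k)"
  by (rule sum.reindex_bij_witness[where i = "\<lambda>k. n - k" and j = "\<lambda>k. n - k"])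
     (auto simp: S_term_reflect)

lemma Suc_times_central_binomial:
  "Suc k * ((2 * Suc k) choose Suc k) = 2 * (2 * k + 1) * ((2 * k) choose k)"
proof -
  have a: "Suc k * (Suc (2*k+1) choose Suc k) = Suc (2*k+1) * ((2*k+1) choose k)"
    by (rule Suc_times_binomial)
  have b: "(Suc (2*k) - k) * (Suc (2*k) choose k) = Suc (2*k) * ((2*k) choose k)"
    using binomial_absorb_comp[of "Suc (2*k)" k] by simp
  have "Suc k * (Suc k * (Suc (2*k+1) choose Suc k)) = 2 * Suc k * (Suc k * ((2*k+1) choose k))"
    unfolding a by (simp add: algebra_simps)
  also have "\<dots> = 2 * Suc k * ((2*k+1) * ((2*k) choose k))"
    using b by (simp add: Suc_diff_le)
  also have "\<dots> = Suc k * (2 * (2*k+1) * ((2*k) choose k))"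
    by (simp only: ac_simps)
  finally have "Suc k * (Suc (2*k+1) choose Suc k) = 2 * (2*k+1) * ((2*k) choose k)"
    by (simp only: mult_cancel1) simp
  then show ?thesis by simp
qed

text \<open>One factor \<open>k + 1\<close> is absorbed by the outer binomial coefficient, the other
  by the central one at \<open>k + 1\<close>; the third coefficient stays the same because
  \<open>Suc n - Suc k = n - k\<close>.\<close>

lemma Suc_power2_times_S_term:
  assumes "k \<le> n"
  shows "(int (Suc k))\<^sup>2 * S_term (Suc n) (Suc k) = 2 * int (Suc n) * (2 * int k + 1) * S_term n k"
proof -
  have a: "int (Suc k) * int (Suc n choose Suc k) = int (Suc n) * int (n choose k)"
    using Suc_times_binomial[of k n] by (simp only: of_nat_mult [symmetric])
  have b: "int (Suc k) * int ((2 * Suc k) choose Suc k) = 2 * (2 * int k + 1) * int ((2 * k) choose k)"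
    using arg_cong[OF Suc_times_central_binomial[of k], of int]
    by (simp only: of_nat_mult of_nat_add of_nat_numeral of_nat_1)
  have "(int (Suc k))\<^sup>2 * S_term (Suc n) (Suc k)
     = (int (Suc k) * int (Suc n choose Suc k)) * (int (Suc k) * int ((2 * Suc k) choose Suc k))
        * int ((2*(n-k)) choose (n-k))"
    unfolding S_term_def power2_eq_square by (simp only: ac_simps diff_Suc_Suc)
  also have "\<dots> = 2 * int (Suc n) * (2 * int k + 1) * S_term n k"
    unfolding a b S_term_def by (simp only: ac_simps)
  finally show ?thesis .
qed

text \<open>The weight \<open>k^2\<close> kills the term at \<open>k = 0\<close>, so shifting the
  index turns a moment at level \<open>n + 1\<close> into one of lower degree at level
  \<open>n\<close>.\<close>

lemma sum_power2_times_S_term: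
  "(\<Sum>k\<le>Suc n. f k * (int k)\<^sup>2 * S_term (Suc n) k)
    = 2 * int (Suc n) * (\<Sum>k\<le>n. f (Suc k) * (2 * int k + 1) * S_term n k)"
proof -
  have "(\<Sum>k\<le>Suc n. f k * (int k)\<^sup>2 * S_term (Suc n) k)
      = (\<Sum>k\<le>n. f (Suc k) * ((int (Suc k))\<^sup>2 * S_term (Suc n) (Suc k)))"
    by (subst sum.atMost_Suc_shift) (simp add: mult.assoc)
  also have "\<dots> = (\<Sum>k\<le>n. f (Suc k) * (2 * int (Suc n) * (2 * int k + 1) * S_term n k))"
    by (intro sum.cong refl arg_cong2[of _ _ _ _ "(*)"] Suc_power2_times_S_term) simp
  finally show ?thesis
    by (simp only: sum_distrib_left ac_simps)
qed

text \<open>By symmetry the weights \<open>k\<close> and \<open>n - k\<close> give the same sum, and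
  they add up to \<open>n\<close>.\<close>

lemma S_first_moment: "2 * (\<Sum>k\<le>n. int k * S_term n k) = int n * S n"
proof -
  have "2 * (\<Sum>k\<le>n. int k * S_term n k)
      = (\<Sum>k\<le>n. int k * S_term n k) + (\<Sum>k\<le>n. int (n - k) * S_term n k)"
    using sum_S_term_reflect[of int n] by simp
  also have "\<dots> = (\<Sum>k\<le>n. int n * S_term n k)"
    unfolding sum.distrib [symmetric] by (rule sum.cong) (auto simp: of_nat_diff algebra_simps)
  finally show ?thesis by (simp add: S_eq_sum_S_term sum_distrib_left)
qed

text \<open>The index shift with constant weight leaves the weight \<open>2k + 1\<close>, which the
  first moment evaluates. At \<open>n = 0\<close> the truncated \<open>n - 1\<close> is harmless,
  since its coefficient vanishes.\<close>

lemma S_second_moment: "(\<Sum>k\<le>n. (int k)\<^sup>2 * S_term n k) = 2 * (int n)\<^sup>2 * S (n - 1)"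
proof (cases n)
  case (Suc m)
  have "(\<Sum>k\<le>Suc m. (int k)\<^sup>2 * S_term (Suc m) k)
      = 2 * int (Suc m) * (\<Sum>k\<le>m. (2 * int k + 1) * S_term m k)"
    using sum_power2_times_S_term[of "\<lambda>_. 1" m] by simp
  also have "(\<Sum>k\<le>m. (2 * int k + 1) * S_term m k) = 2 * (\<Sum>k\<le>m. int k * S_term m k) + S m"
    by (simp add: algebra_simps sum.distrib sum_distrib_left S_eq_sum_S_term)
  also have "\<dots> = int (Suc m) * S m"
    unfolding S_first_moment by (simp add: algebra_simps)
  finally show ?thesis using Suc by (simp add: power2_eq_square algebra_simps)
qed simp

text \<open>Writing \<open>(n+1)\<^sup>3 = f k + f (n+1-k)\<close> with \<open>f k = k\<^sup>3 + 3k\<^sup>2(n+1-k)\<close>, the symmetry of the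
  summands leaves only terms divisible by \<open>k\<^sup>2\<close>, which the index shift reduces to moments of
  \<open>S n\<close>.\<close>

lemma S_recurrence:
  "(int n + 1)\<^sup>2 * S (n + 1) = 4 * (3 * (int n)\<^sup>2 + 3 * int n + 1) * S n - 32 * (int n)\<^sup>2 * S (n - 1)"
proof -
  let ?m = "int n + 1"
  let ?f = "\<lambda>k. (2 * int k + 6 * (?m - int k)) * (int k)\<^sup>2"
  have "2 * (?m ^ 3 * S (Suc n)) = (\<Sum>k\<le>Suc n. ?f k * S_term (Suc n) k)
           + (\<Sum>k\<le>Suc n. ?f (Suc n - k) * S_term (Suc n) k)"
    unfolding sum.distrib [symmetric] S_eq_sum_S_term sum_distrib_left
    by (rule sum.cong)
       (auto simp: of_nat_diff algebra_simps power2_eq_square power3_eq_cube)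
  also have "\<dots> = 2 * (\<Sum>k\<le>Suc n. (2 * int k + 6 * (?m - int k)) * (int k)\<^sup>2 * S_term (Suc n) k)"
    using sum_S_term_reflect[of ?f "Suc n"] by simp
  also have "\<dots> = 2 * (2 * ?m * (\<Sum>k\<le>n. (2 * int (Suc k) + 6 * (?m - int (Suc k))) * (2 * int k + 1) * S_term n k))"
    unfolding sum_power2_times_S_term by (simp add: add.commute)
  also have "(\<Sum>k\<le>n. (2 * int (Suc k) + 6 * (?m - int (Suc k))) * (2 * int k + 1) * S_term n k)
      = (6 * int n + 2) * S n + 6 * int n * (2 * (\<Sum>k\<le>n. int k * S_term n k))
          - 8 * (\<Sum>k\<le>n. (int k)\<^sup>2 * S_term n k)"
    unfolding S_eq_sum_S_term sum_distrib_left sum.distrib [symmetric] sum_subtractf [symmetric]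
    by (rule sum.cong) (auto simp: algebra_simps power2_eq_square)
  finally have "?m * (?m\<^sup>2 * S (n + 1)) = ?m * (4 * (3 * (int n)\<^sup>2 + 3 * int n + 1) * S n - 32 * (int n)\<^sup>2 * S (n - 1))"
    unfolding S_first_moment S_second_moment by (simp add: algebra_simps power2_eq_square power3_eq_cube)
  then show ?thesis by (simp only: mult_cancel_left) auto
qed

subsection \<open>Summands at indices not divisible by the prime\<close>

lemma prime_dvd_binomial:
  assumes "prime p" "0 < k" "k < p"
  shows "p dvd (p choose k)"
proof -
  have "k * (p choose k) = p * ((p - 1) choose (k - 1))"
    using assms by (simp add: times_binomial_minus1_eq)
  then have "p dvd k * (p choose k)" by simp
  moreover have "\<not> p dvd k" using assms by (auto dest: dvd_imp_le)
  ultimately show ?thesis using assms prime_dvd_mult_iff by blast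
qed

text \<open>This is \<open>(1 + X)^p = 1 + X^p\<close> modulo \<open>p\<close>, read off
  coefficientwise: in Vandermonde's sum only \<open>i = 0\<close> and \<open>i = p\<close>
  survive.\<close>

lemma binomial_add_prime_cong:
  assumes "prime p"
  shows "[(p + m) choose k = (m choose k) + (if p \<le> k then m choose (k - p) else 0)] (mod p)"
proof -
  have "[(p + m) choose k = (\<Sum>i\<le>k. (p choose i) * (m choose (k - i)))] (mod p)"
    by (simp add: vandermonde)
  also have "[(\<Sum>i\<le>k. (p choose i) * (m choose (k - i)))
      = (\<Sum>i\<le>k. (if i = 0 then m choose k else 0) + (if i = p then m choose (k - p) else 0))] (mod p)"
  proof (rule cong_sum)
    fix i
    consider "i = 0" | "0 < i" "i < p" | "i = p" | "i > p" by linarith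
    then show "[(p choose i) * (m choose (k - i))
        = (if i = 0 then m choose k else 0) + (if i = p then m choose (k - p) else 0)] (mod p)"
    proof cases
      case 2
      then show ?thesis using prime_dvd_binomial[OF assms 2] by (simp add: cong_0_iff)
    next
      case 4
      then show ?thesis by (simp add: binomial_eq_0)
    qed (use prime_gt_0_nat[OF assms] in auto)
  qed
  also have "(\<Sum>i\<le>k. (if i = 0 then m choose k else 0) + (if i = p then m choose (k - p) else 0))
      = (m choose k) + (if p \<le> k then m choose (k - p) else 0)"
    by (simp add: sum.distrib)
  finally show ?thesis .
qed

text \<open>Splitting \<open>p\<close> off the upper index turns into Pascal's rule for
  \<open>a choose b\<close>, hence the induction on \<open>a\<close>.\<close>

lemma binomial_lucas_cong:
  assumes "prime p" "r < p" "s < p"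
  shows "[(p * a + r) choose (p * b + s) = (a choose b) * (r choose s)] (mod p)"
proof (induction a arbitrary: b)
  case 0
  show ?case
  proof (cases b)
    case (Suc c)
    then have "r < p * b + s" using assms by simp
    then show ?thesis using Suc by (simp add: binomial_eq_0)
  qed simp
next
  case (Suc a)
  have eq: "p * Suc a + r = p + (p * a + r)" by simp
  show ?case
  proof (cases b)
    case 0
    have "[(p * Suc a + r) choose s = (p * a + r) choose s] (mod p)"
      unfolding eq using binomial_add_prime_cong[OF assms(1), of "p * a + r" s] assms by simp
    also have "[(p * a + r) choose s = r choose s] (mod p)" using Suc.IH[of 0] by simp
    finally show ?thesis using 0 by simp
  next
    case (Suc c)
    have "[(p * Suc a + r) choose (p * b + s)
        = ((p * a + r) choose (p * b + s)) + ((p * a + r) choose (p * c + s))] (mod p)"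
      unfolding eq using binomial_add_prime_cong[OF assms(1), of "p * a + r" "p * b + s"] Suc by simp
    also have "[((p * a + r) choose (p * b + s)) + ((p * a + r) choose (p * c + s))
        = (a choose b) * (r choose s) + (a choose c) * (r choose s)] (mod p)"
      by (intro cong_add Suc.IH)
    finally show ?thesis using Suc by (simp add: algebra_simps)
  qed
qed

lemma binomial_lucas_cong_int:
  assumes "prime p" "r < p" "s < p"
  shows "[int ((p * a + r) choose (p * b + s)) = int (a choose b) * int (r choose s)] (mod int p)"
  using binomial_lucas_cong[OF assms, of a b] by (metis cong_int_iff of_nat_mult)

text \<open>Neighbouring coefficients add up to a multiple of \<open>p\<close> by Pascal's rule, so
  the sign alternates.\<close>

lemma binomial_prime_minus_1_cong:
  assumes "prime p" "k < p"
  shows "[int ((p - 1) choose k) = (-1) ^ k] (mod int p)"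
  using assms(2)
proof (induction k)
  case (Suc k)
  have "p choose Suc k = ((p - 1) choose k) + ((p - 1) choose Suc k)"
    using choose_reduce_nat[of p "Suc k"] prime_gt_0_nat[OF assms(1)] by simp
  moreover have "int p dvd int (p choose Suc k)"
    using prime_dvd_binomial[OF assms(1) _ Suc.prems] by simp
  ultimately have "[int ((p - 1) choose k) + int ((p - 1) choose Suc k) = 0] (mod int p)"
    by (simp add: cong_0_iff)
  from cong_diff[OF this Suc.IH] Suc.prems show ?case by simp
qed simp

lemma prime_power_cong_1:
  assumes "prime p" "0 < t" "t < p"
  shows "[(int t) ^ (p - 1) = 1] (mod int p)"
proof -
  have "[t ^ (p - 1) = 1] (mod p)"
    using assms by (intro fermat_theorem) (auto dest: dvd_imp_le)
  then show ?thesis by (metis cong_int_iff of_nat_1 of_nat_power)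
qed

lemma coprime_int_less_prime:
  assumes "prime p" "0 < t" "t < p"
  shows "coprime (int t) (int p)"
proof -
  have "\<not> p dvd t" using assms(2,3) by (auto dest: dvd_imp_le)
  then have "coprime p t" using assms(1) prime_imp_coprime by blast
  then show ?thesis by (simp add: coprime_commute)
qed

text \<open>Lets the integer \<open>t ^ (p - 3)\<close> play the role of \<open>1/t^2\<close> modulo
  \<open>p\<close>, by Fermat's theorem.\<close>

lemma power2_times_power_prime_minus_3_cong:
  assumes "prime p" "odd p" "0 < t" "t < p"
  shows "[(int t)\<^sup>2 * int t ^ (p - 3) = 1] (mod int p)"
proof -
  have "p \<ge> 3" using assms(1,2) prime_ge_2_nat[of p] by (cases "p = 2") auto
  then have "p - 1 = 2 + (p - 3)" by simp
  then have "(int t)\<^sup>2 * int t ^ (p - 3) = int t ^ (p - 1)"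
    by (simp only: power_add)
  then show ?thesis using prime_power_cong_1[OF assms(1,3,4)] by simp
qed

text \<open>For \<open>0 < 2r < p\<close> the numbers \<open>pi - r\<close> have remainder above \<open>p/2\<close>, so one factor \<open>p\<close>
  appears in their central binomial coefficient.\<close>

lemma central_binomial_below_multiple:
  assumes "prime p" "odd p" "0 < r" "2 * r < p" "0 < i"
  shows "\<exists>v. int ((2 * (p * i - r)) choose (p * i - r)) = int p * v
     \<and> [int r * int ((2 * r) choose r) * v = - (int i * int ((2 * i) choose i))] (mod int p)"
  using assms(3,4)
proof (induction r rule: nat_induct_non_zero)
  let ?C = "\<lambda>m. int ((2 * m) choose m)"
  have step: "int (p * i - r) * ?C (p * i - r)
      = 2 * (2 * int p * int i - (2 * int r + 1)) * ?C (p * i - Suc r)" if "2 * r < p" for r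
  proof -
    have "r < p * i" using that assms(5) by (cases i) auto
    then have le: "p * i - r = Suc (p * i - Suc r)" "Suc r \<le> p * i"
      by auto
    show ?thesis
      using arg_cong[OF Suc_times_central_binomial[of "p * i - Suc r"], of int]
      unfolding le(1) [symmetric] using le(2)
      by (simp only: of_nat_mult of_nat_add of_nat_diff) (simp add: algebra_simps)
  qed
  \<comment> \<open>Modulo \<open>p\<close> the coefficient in \<open>step\<close> is
    \<open>-2(2r+1)\<close>, a unit in the range considered, so divisibility by \<open>p\<close>
    passes to the central binomial coefficient.\<close>
  have cop: "coprime (2 * (2 * int p * int i - (2 * int r + 1))) (int p)" if "2 * r + 1 < p" for r
  proof -
    have "coprime (int (2 * r + 1)) (int p)"
      using assms(1) that by (intro coprime_int_less_prime) auto
    then have "coprime (- int (2 * r + 1)) (int p)" by (simp only: coprime_minus_left_iff)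
    moreover have "[- int (2 * r + 1) = 2 * int p * int i - (2 * int r + 1)] (mod int p)"
      by (simp add: cong_iff_dvd_diff)
    ultimately have "coprime (2 * int p * int i - (2 * int r + 1)) (int p)"
      by (rule cong_imp_coprime [rotated])
    moreover have "coprime 2 (int p)" using assms(2) by simp
    ultimately show ?thesis by (simp only: coprime_mult_left_iff)
  qed
  {
    case 1
    \<comment> \<open>At \<open>r = 0\<close> the recurrence carries the factor \<open>p * i\<close>
      on the left; this is where the factor \<open>p\<close> originates.\<close>
    have s: "int p * (int i * ?C (p * i)) = 2 * (2 * int p * int i - 1) * ?C (p * i - 1)"
      using step[of 0] 1 by simp
    then have "int p dvd 2 * (2 * int p * int i - 1) * ?C (p * i - 1)"
      by (metis dvd_triv_left)
    then have "int p dvd ?C (p * i - 1)"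
      using cop[of 0] 1 by (simp add: coprime_commute coprime_dvd_mult_right_iff)
    then obtain v where v: "?C (p * i - 1) = int p * v" by (elim dvdE)
    have "int p * (int i * ?C (p * i)) = int p * (2 * (2 * int p * int i - 1) * v)"
      using s unfolding v by (simp only: ac_simps)
    then have "int i * ?C (p * i) = 2 * (2 * int p * int i - 1) * v"
      using prime_gt_0_nat[OF assms(1)] by simp
    then have "2 * v = - (int i * ?C (p * i)) + int p * (4 * int i * v)"
      by (simp add: algebra_simps)
    then have "[2 * v = - (int i * ?C (p * i))] (mod int p)"
      by (simp add: cong_iff_dvd_diff)
    also have "[- (int i * ?C (p * i)) = - (int i * ?C i)] (mod int p)"
      using binomial_lucas_cong_int[OF assms(1), of 0 0 "2 * i" i] prime_gt_0_nat[OF assms(1)]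
      by (simp add: cong_minus_minus_iff cong_scalar_left mult.left_commute)
    finally show ?case using v by (auto intro!: exI[of _ v])
  next
    case (Suc r)
    then obtain v where v: "?C (p * i - r) = int p * v"
        "[int r * ?C r * v = - (int i * ?C i)] (mod int p)" by auto
    have s: "int p * (int (p * i - r) * v) = 2 * (2 * int p * int i - (2 * int r + 1)) * ?C (p * i - Suc r)"
      using step[of r] Suc v(1) by (simp add: mult.left_commute)
    then have "int p dvd 2 * (2 * int p * int i - (2 * int r + 1)) * ?C (p * i - Suc r)"
      by (metis dvd_triv_left)
    then have "int p dvd ?C (p * i - Suc r)"
      using cop[of r] Suc by (simp add: coprime_commute coprime_dvd_mult_right_iff)
    then obtain w where w: "?C (p * i - Suc r) = int p * w" by (elim dvdE)
    have "int p * (int (p * i - r) * v) = int p * (2 * (2 * int p * int i - (2 * int r + 1)) * w)"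
      using s unfolding w by (simp only: ac_simps)
    then have e: "int (p * i - r) * v = 2 * (2 * int p * int i - (2 * int r + 1)) * w"
      using prime_gt_0_nat[OF assms(1)] by simp
    have "r \<le> p * i" using Suc assms(5) by (cases i) auto
    then have "int (p * i - r) = int p * int i - int r" by (simp add: of_nat_diff)
    from e [unfolded this]
    have "2 * (2 * int r + 1) * w = int r * v + int p * (4 * int i * w - int i * v)"
      by (simp add: algebra_simps)
    then have c: "[2 * (2 * int r + 1) * w = int r * v] (mod int p)"
      by (simp add: cong_iff_dvd_diff)
    \<comment> \<open>The factor \<open>r * ?C r\<close> in the invariant obeys the recurrence that
      cancels the one from \<open>v\<close> to \<open>w\<close>, which keeps the right-hand side
      constant.\<close>
    have "int (Suc r) * ?C (Suc r) * w = ?C r * (2 * (2 * int r + 1) * w)"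
      using arg_cong[OF Suc_times_central_binomial[of r], of int]
      by (simp only: of_nat_mult of_nat_add of_nat_numeral of_nat_1 ac_simps)
    also have "[\<dots> = ?C r * (int r * v)] (mod int p)" by (intro cong_scalar_left c)
    also have "?C r * (int r * v) = int r * ?C r * v" by simp
    also note v(2)
    finally show ?case using w by blast
  }
qed

text \<open>The outer binomial coefficient and the central one at \<open>p(n-j) - r\<close> each
  supply a factor \<open>p\<close>. Their cofactors \<open>u\<close> and \<open>v\<close> matter
  only modulo \<open>p\<close>, where each carries a denominator \<open>r\<close>; the remaining
  coefficient contributes \<open>?C j * ?C r\<close>, whose second factor completes the congruence
  for \<open>v\<close>.\<close>

lemma S_term_offset_cong:
  assumes "prime p" "odd p" "0 < r" "2 * r < p" "j < n"
  shows "[S_term (p * n) (p * j + r)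
     = (int p)\<^sup>2 * ((-1) ^ r * int r ^ (p - 3) * ((int (n - j))\<^sup>2 * S_term n j))] (mod (int p) ^ 3)"
proof -
  let ?C = "\<lambda>m. int ((2 * m) choose m)"
  define i where "i = n - j"
  define b where "b = (p * n - 1) choose (p * j + (r - 1))"
  have p0: "p > 0" using assms(1) prime_gt_0_nat by blast
  have i: "i > 0" "n = i + j" using assms(5) by (auto simp: i_def)
  obtain m where m: "n = Suc m" using assms(5) by (cases n) auto
  have diff: "p * n - (p * j + r) = p * i - r"
    using i by (simp add: algebra_simps)
  obtain v where v: "?C (p * i - r) = int p * v"
      "[int r * ?C r * v = - (int i * ?C i)] (mod int p)"
    using central_binomial_below_multiple[OF assms(1-4) i(1)] by blast
  \<comment> \<open>Absorption \<open>k (N choose k) = N (N-1 choose k-1)\<close> with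
    \<open>N = pn\<close> and \<open>k\<close> prime to \<open>p\<close> exposes the factor
    \<open>p\<close>.\<close>
  have b: "int (p * j + r) * int ((p * n) choose (p * j + r)) = int p * (int n * int b)"
    using arg_cong[OF times_binomial_minus1_eq[of "p * j + r" "p * n"], of int] assms(3)
    by (simp only: of_nat_mult b_def) (simp add: mult.assoc)
  have "\<not> p dvd r" using assms(3,4) by (auto dest: dvd_imp_le)
  then have "coprime (int p) (int (p * j + r))"
    using assms(1) by (simp only: coprime_int_iff) (rule prime_imp_coprime, auto simp: dvd_add_right_iff)
  moreover have "int p dvd int (p * j + r) * int ((p * n) choose (p * j + r))"
    unfolding b by simp
  ultimately have "int p dvd int ((p * n) choose (p * j + r))"
    using coprime_dvd_mult_right_iff by blast
  then obtain u where u: "int ((p * n) choose (p * j + r)) = int p * u" by (elim dvdE)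
  have "int p * (int (p * j + r) * u) = int p * (int n * int b)"
    using b unfolding u by (simp only: ac_simps)
  then have "int (p * j + r) * u = int n * int b" using p0 by simp
  then have "int r * u = int n * int b + int p * (- (int j * u))"
    by (simp add: algebra_simps)
  then have u1: "[int r * u = int n * int b] (mod int p)" by (simp add: cong_iff_dvd_diff)
  \<comment> \<open>The last base-\<open>p\<close> digit of \<open>pn - 1\<close> is
    \<open>p - 1\<close>, so Lucas' theorem yields the sign \<open>(-1)^(r-1)\<close>.\<close>
  have "p * n - 1 = p * m + (p - 1)" using p0 m by simp
  then have "[int b = int (m choose j) * int ((p - 1) choose (r - 1))] (mod int p)"
    unfolding b_def using assms p0 by (simp only:) (intro binomial_lucas_cong_int; simp)
  also have "[int (m choose j) * int ((p - 1) choose (r - 1)) = int (m choose j) * (-1) ^ (r - 1)] (mod int p)"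
    using assms by (intro cong_scalar_left binomial_prime_minus_1_cong) auto
  finally have "[int n * int b = int n * (int (m choose j) * (-1) ^ (r - 1))] (mod int p)"
    by (rule cong_scalar_left)
  also have "int n * (int (m choose j) * (-1) ^ (r - 1)) = - ((-1) ^ r * (int i * int (n choose j)))"
  proof -
    have "int n * int (m choose j) = int i * int (n choose j)"
      using arg_cong[OF binomial_absorb_comp[of n j], of int] m
      by (simp only: of_nat_mult i_def diff_Suc_1)
    then have "int n * (int (m choose j) * (-1) ^ (r - 1)) = int i * int (n choose j) * (-1) ^ (r - 1)"
      by (simp only: mult.assoc [symmetric])
    then show ?thesis using assms(3) by (cases r) auto
  qed
  finally have u2: "[int n * int b = - ((-1) ^ r * (int i * int (n choose j)))] (mod int p)" .
  have w: "[?C (p * j + r) = ?C j * ?C r] (mod int p)"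
    using binomial_lucas_cong_int[OF assms(1), of "2 * r" r "2 * j" j] assms(4)
    by (simp add: algebra_simps)
  have "(int r)\<^sup>2 * (u * ?C (p * j + r) * v) = (int r * u) * ?C (p * j + r) * (int r * v)"
    by (simp add: power2_eq_square)
  also have "[\<dots> = - ((-1) ^ r * (int i * int (n choose j))) * (?C j * ?C r) * (int r * v)] (mod int p)"
    by (intro cong_mult cong_refl w cong_trans[OF u1 u2])
  also have "- ((-1) ^ r * (int i * int (n choose j))) * (?C j * ?C r) * (int r * v)
      = - ((-1) ^ r * (int i * int (n choose j))) * ?C j * (int r * ?C r * v)"
    by (simp only: ac_simps)
  also have "[\<dots> = - ((-1) ^ r * (int i * int (n choose j))) * ?C j * - (int i * ?C i)] (mod int p)"
    by (intro cong_scalar_left v)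
  also have "- ((-1) ^ r * (int i * int (n choose j))) * ?C j * - (int i * ?C i)
       = (-1) ^ r * ((int i)\<^sup>2 * S_term n j)"
    by (simp add: S_term_def power2_eq_square i_def)
  finally have "[int r ^ (p - 3) * ((int r)\<^sup>2 * (u * ?C (p * j + r) * v))
     = int r ^ (p - 3) * ((-1) ^ r * ((int i)\<^sup>2 * S_term n j))] (mod int p)"
    by (rule cong_scalar_left)
  moreover have "[((int r)\<^sup>2 * int r ^ (p - 3)) * (u * ?C (p * j + r) * v) = 1 * (u * ?C (p * j + r) * v)] (mod int p)"
    using assms by (intro cong_scalar_right power2_times_power_prime_minus_3_cong) auto
  ultimately have "[u * ?C (p * j + r) * v = (-1) ^ r * int r ^ (p - 3) * ((int i)\<^sup>2 * S_term n j)] (mod int p)"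
    by (simp add: ac_simps cong_def)
  \<comment> \<open>Multiplying by \<open>p^2\<close> lifts the congruence from modulus
    \<open>p\<close> to \<open>p^3\<close>.\<close>
  then have "[(int p)\<^sup>2 * (u * ?C (p * j + r) * v)
     = (int p)\<^sup>2 * ((-1) ^ r * int r ^ (p - 3) * ((int i)\<^sup>2 * S_term n j))] (mod ((int p)\<^sup>2 * int p))"
    by (rule cong_cmult_leftI)
  moreover have "S_term (p * n) (p * j + r) = (int p)\<^sup>2 * (u * ?C (p * j + r) * v)"
    unfolding S_term_def diff u v(1) by (simp add: power2_eq_square)
  moreover have "(int p)\<^sup>2 * int p = (int p) ^ 3" by (simp add: power2_eq_square power3_eq_cube)
  ultimately show ?thesis by (simp add: i_def)
qed

subsection \<open>Binomial coefficients of multiples of a prime\<close>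

text \<open>The factors of a factorial strictly between the consecutive multiples \<open>pj\<close>
  and \<open>p(j+1)\<close>; for prime \<open>p\<close> they are prime to \<open>p\<close>.\<close>

definition block_prod :: "nat \<Rightarrow> nat \<Rightarrow> int" where
  "block_prod p j = (\<Prod>t=1..<p. int p * int j + int t)"

lemma fact_add_prod: "fact (m + q) = (fact m :: int) * (\<Prod>t=1..<Suc q. int m + int t)"
  by (induction q) (simp_all add: algebra_simps)

lemma fact_mult_block_prod:
  assumes "p > 0"
  shows "fact (p * a) = (int p ^ a * fact a :: int) * (\<Prod>j<a. block_prod p j)"
proof (induction a)
  case (Suc a)
  have "fact (p * Suc a) = (fact (p * a) :: int) * (\<Prod>t=1..<Suc p. int (p * a) + int t)"
    using fact_add_prod[of "p * a" p] by (simp add: add.commute)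
  also have "(\<Prod>t=1..<Suc p. int (p * a) + int t) = block_prod p a * (int p * int (Suc a))"
    using assms by (simp add: block_prod_def algebra_simps)
  finally show ?case
    unfolding Suc.IH by (simp add: algebra_simps)
qed simp

text \<open>The multiples of \<open>p\<close> inside the three factorials assemble to the small
  binomial coefficient, their powers of \<open>p\<close> cancel, and only the blocks remain. The
  form is free of division.\<close>

lemma binomial_mult_block_prod:
  assumes "p > 0"
  shows "int ((p * (b + c)) choose (p * b)) * ((\<Prod>j<b. block_prod p j) * (\<Prod>j<c. block_prod p j))
       = int ((b + c) choose b) * (\<Prod>j<b+c. block_prod p j)"
proof -
  let ?Q = "\<lambda>a. \<Prod>j<a. block_prod p j"
  let ?F = "int p ^ (b + c) * (fact b * fact c) :: int"
  have a: "fact (p * b) * fact (p * c) * int ((p * (b + c)) choose (p * b)) = fact (p * (b + c))"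
    using arg_cong[OF binomial_fact_lemma[of "p * b" "p * (b + c)"], of int]
    by (simp add: algebra_simps)
  have b: "fact b * fact c * int ((b + c) choose b) = fact (b + c)"
    using arg_cong[OF binomial_fact_lemma[of b "b + c"], of int] by simp
  have "?F * (int ((p * (b + c)) choose (p * b)) * (?Q b * ?Q c))
      = fact (p * b) * fact (p * c) * int ((p * (b + c)) choose (p * b))"
    unfolding fact_mult_block_prod[OF assms] by (simp add: power_add ac_simps)
  also have "\<dots> = int p ^ (b + c) * (fact b * fact c * int ((b + c) choose b)) * ?Q (b + c)"
    unfolding a b by (rule fact_mult_block_prod[OF assms])
  also have "\<dots> = ?F * (int ((b + c) choose b) * ?Q (b + c))"
    by (simp only: ac_simps)
  finally show ?thesis using assms by simp
qed

lemma coprime_block_prod: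
  assumes "prime p"
  shows "coprime (block_prod p j) (int p)"
  unfolding block_prod_def
proof (rule prod_coprime_left)
  fix t assume "t \<in> {1..<p}"
  then have "coprime (int t) (int p)" using assms by (intro coprime_int_less_prime) auto
  moreover have "[int t = int p * int j + int t] (mod int p)" by (simp add: cong_iff_dvd_diff)
  ultimately show "coprime (int p * int j + int t) (int p)"
    by (rule cong_imp_coprime [rotated])
qed

text \<open>This is the sum of all \<open>1/t^2\<close>. Doubling permutes the nonzero residues, so
  the sum equals a quarter of itself; thus three times the sum vanishes, and 3 is
  invertible.\<close>

lemma sum_power_prime_minus_3_cong:
  assumes "prime p" "p > 3"
  shows "[(\<Sum>t=1..<p. int t ^ (p - 3)) = 0] (mod int p)"
proof -
  let ?A = "{1..<p}" and ?f = "\<lambda>t. (2 * t) mod p"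
  let ?s = "\<Sum>t\<in>?A. int t ^ (p - 3)"
  have op: "odd p" using assms by (simp add: prime_odd_nat)
  have "inj_on ?f ?A"
  proof (rule inj_onI)
    fix x y assume xy: "x \<in> ?A" "y \<in> ?A" "?f x = ?f y"
    then have "[2 * x = 2 * y] (mod p)" by (simp add: cong_def)
    then have "[x = y] (mod p)" using op by (simp add: cong_mult_lcancel_nat)
    then show "x = y" using xy by (simp add: cong_def)
  qed
  moreover have "?f ` ?A \<subseteq> ?A"
  proof (rule image_subsetI)
    fix t assume t: "t \<in> ?A"
    have "\<not> p dvd 2 * t"
      using t assms op by (auto simp: prime_dvd_mult_iff dest: dvd_imp_le)
    then show "?f t \<in> ?A"
      using assms by (auto simp: Suc_le_eq mod_greater_zero_iff_not_dvd)
  qed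
  ultimately have bij: "bij_betw ?f ?A ?A"
    by (simp add: bij_betw_def endo_inj_surj)
  have "4 * ?s = 4 * (\<Sum>t\<in>?A. int (?f t) ^ (p - 3))"
    using sum.reindex_bij_betw[OF bij, of "\<lambda>t. int t ^ (p - 3)"] by simp
  also have "[\<dots> = 4 * (\<Sum>t\<in>?A. (2 * int t) ^ (p - 3))] (mod int p)"
    by (intro cong_scalar_left cong_sum cong_pow) (simp add: cong_def zmod_int)
  also have "4 * (\<Sum>t\<in>?A. (2 * int t) ^ (p - 3)) = ((int 2)\<^sup>2 * int 2 ^ (p - 3)) * ?s"
    by (simp add: power_mult_distrib sum_distrib_left mult.assoc)
  also have "[\<dots> = 1 * ?s] (mod int p)"
    using assms op by (intro cong_scalar_right power2_times_power_prime_minus_3_cong) auto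
  finally have "int p dvd 3 * ?s" by (simp add: cong_iff_dvd_diff algebra_simps)
  moreover have "coprime (int p) 3"
    using coprime_int_less_prime[of p 3] assms by (simp add: coprime_commute)
  ultimately show ?thesis by (simp add: cong_0_iff coprime_dvd_mult_right_iff)
qed

text \<open>First-order expansion: every further term contains \<open>y^2\<close>. It is meant for
  \<open>y\<close> divisible by \<open>p^2\<close> and modulus \<open>p^3\<close>.\<close>

lemma prod_one_minus_cong:
  fixes y m :: int
  assumes "finite A" "m dvd y\<^sup>2"
  shows "[(\<Prod>t\<in>A. 1 - y * c t) = 1 - y * (\<Sum>t\<in>A. c t)] (mod m)"
  using assms(1)
proof (induction A)
  case (insert x A)
  have "[(\<Prod>t\<in>insert x A. 1 - y * c t) = (1 - y * c x) * (1 - y * (\<Sum>t\<in>A. c t))] (mod m)"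
    using insert by (simp add: cong_scalar_left)
  moreover have "(1 - y * c x) * (1 - y * (\<Sum>t\<in>A. c t))
     = 1 - y * (\<Sum>t\<in>insert x A. c t) + y\<^sup>2 * (c x * (\<Sum>t\<in>A. c t))"
    using insert by (simp add: algebra_simps power2_eq_square)
  moreover have "[1 - y * (\<Sum>t\<in>insert x A. c t) + y\<^sup>2 * (c x * (\<Sum>t\<in>A. c t))
     = 1 - y * (\<Sum>t\<in>insert x A. c t)] (mod m)"
    using assms(2) by (simp add: cong_iff_dvd_diff)
  ultimately show ?case by (metis cong_trans)
qed simp

text \<open>Pairing the factors with indices \<open>t\<close> and \<open>p - t\<close> makes the square of the block a product of
  terms \<open>t(p-t) + p\<^sup>2(j\<^sup>2+j)\<close>.\<close>

lemma block_prod_cong: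
  assumes "prime p" "p > 3"
  shows "[block_prod p j = block_prod p 0] (mod (int p) ^ 3)"
proof -
  let ?A = "{1..<p}" and ?c = "\<lambda>t. int t ^ (p - 3)"
  define y where "y = (int p)\<^sup>2 * ((int j)\<^sup>2 + int j)"
  have op: "odd p" using assms by (simp add: prime_odd_nat)
  have sq: "(block_prod p i)\<^sup>2 = (\<Prod>t\<in>?A. (int p)\<^sup>2 * ((int i)\<^sup>2 + int i) + int t * (int p - int t))" for i
  proof -
    have "block_prod p i = (\<Prod>t\<in>?A. int p * int i + (int p - int t))"
      unfolding block_prod_def
      by (rule prod.reindex_bij_witness[where i = "\<lambda>t. p - t" and j = "\<lambda>t. p - t"])
         (auto simp: of_nat_diff)
    then have "(block_prod p i)\<^sup>2 = (\<Prod>t\<in>?A. int p * int i + int t)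
        * (\<Prod>t\<in>?A. int p * int i + (int p - int t))"
      by (simp add: power2_eq_square block_prod_def)
    then show ?thesis
      unfolding prod.distrib [symmetric]
      by (simp add: algebra_simps power2_eq_square)
  qed
  have "(int p) ^ 3 dvd ((int p)\<^sup>2)\<^sup>2"
    by (simp add: le_imp_power_dvd flip: power_mult)
  then have y2: "(int p) ^ 3 dvd y\<^sup>2" by (simp add: y_def power_mult_distrib)
  \<comment> \<open>As \<open>y\<close> is a multiple of \<open>p^2\<close>, its cofactor matters
    only modulo \<open>p\<close>, where \<open>t(p-t)\<close> is \<open>-t^2\<close>; hence
    \<open>y\<close> may be replaced by \<open>-t(p-t) y t^(p-3)\<close>.\<close>
  have "[(block_prod p j)\<^sup>2 = (\<Prod>t\<in>?A. (int t * (int p - int t)) * (1 - y * ?c t))] (mod (int p) ^ 3)"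
    unfolding sq y_def [symmetric]
  proof (rule cong_prod)
    fix t assume "t \<in> ?A"
    then have "[(int t)\<^sup>2 * ?c t = 1] (mod int p)"
      using assms op by (intro power2_times_power_prime_minus_3_cong) auto
    then have "int p dvd 1 - (int t)\<^sup>2 * ?c t"
      by (metis cong_iff_dvd_diff cong_sym)
    then have "int p dvd 1 - (int t)\<^sup>2 * ?c t + int p * (int t * ?c t)"
      by simp
    then have "(int p)\<^sup>2 * int p dvd y * (1 - (int t)\<^sup>2 * ?c t + int p * (int t * ?c t))"
      unfolding y_def by (intro mult_dvd_mono) auto
    moreover have "y * (1 - (int t)\<^sup>2 * ?c t + int p * (int t * ?c t))
        = (y + int t * (int p - int t)) - (int t * (int p - int t)) * (1 - y * ?c t)"
      by (simp add: algebra_simps power2_eq_square)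
    moreover have "(int p)\<^sup>2 * int p = (int p) ^ 3"
      by (simp add: power2_eq_square power3_eq_cube)
    ultimately show "[y + int t * (int p - int t) = (int t * (int p - int t)) * (1 - y * ?c t)] (mod (int p) ^ 3)"
      by (simp add: cong_iff_dvd_diff)
  qed
  also have "(\<Prod>t\<in>?A. (int t * (int p - int t)) * (1 - y * ?c t))
      = (block_prod p 0)\<^sup>2 * (\<Prod>t\<in>?A. 1 - y * ?c t)"
    unfolding sq by (simp add: prod.distrib)
  also have "[\<dots> = (block_prod p 0)\<^sup>2 * (1 - y * (\<Sum>t\<in>?A. ?c t))] (mod (int p) ^ 3)"
    using y2 by (intro cong_scalar_left prod_one_minus_cong) auto
  also have "[(block_prod p 0)\<^sup>2 * (1 - y * (\<Sum>t\<in>?A. ?c t)) = (block_prod p 0)\<^sup>2 * 1] (mod (int p) ^ 3)"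
  proof (intro cong_scalar_left)
    have "(int p)\<^sup>2 * int p dvd y * (\<Sum>t\<in>?A. ?c t)"
      unfolding y_def using sum_power_prime_minus_3_cong[OF assms]
      by (intro mult_dvd_mono) (auto simp: cong_0_iff)
    then show "[1 - y * (\<Sum>t\<in>?A. ?c t) = 1] (mod (int p) ^ 3)"
      by (simp add: cong_iff_dvd_diff power2_eq_square power3_eq_cube)
  qed
  \<comment> \<open>The squares agree modulo \<open>p^3\<close>. The sum of the two blocks is twice
    a unit modulo \<open>p\<close>, so the whole of \<open>p^3\<close> divides their
    difference.\<close>
  finally have "(int p) ^ 3 dvd (block_prod p j + block_prod p 0) * (block_prod p j - block_prod p 0)"
    by (simp add: cong_iff_dvd_diff algebra_simps power2_eq_square)
  moreover have "coprime (block_prod p j + block_prod p 0) (int p)"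
  proof -
    have "[block_prod p j + block_prod p 0 = block_prod p 0 + block_prod p 0] (mod int p)"
      unfolding block_prod_def
      by (intro cong_add cong_prod cong_refl) (simp add: cong_iff_dvd_diff)
    then have "[block_prod p j + block_prod p 0 = 2 * block_prod p 0] (mod int p)" by simp
    moreover have "coprime (2 * block_prod p 0) (int p)"
      using coprime_block_prod[OF assms(1)] op by simp
    ultimately show ?thesis using cong_imp_coprime cong_sym by blast
  qed
  ultimately show ?thesis
    by (simp add: cong_iff_dvd_diff coprime_dvd_mult_right_iff coprime_commute)
qed

text \<open>All blocks agree modulo \<open>p^3\<close>, so both sides of the block identity carry
  the same power of the unit \<open>block_prod p 0\<close>, which cancels.\<close>

lemma binomial_mult_prime_cong:
  assumes "prime p" "p > 3" "b \<le> a"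
  shows "[int ((p * a) choose (p * b)) = int (a choose b)] (mod (int p) ^ 3)"
proof -
  obtain c where a: "a = b + c" using assms(3) le_Suc_ex by blast
  let ?P = "block_prod p 0" and ?Q = "\<lambda>a. \<Prod>j<a. block_prod p j"
  have Q: "[?Q d = ?P ^ d] (mod (int p) ^ 3)" for d
    using cong_prod[of "{..<d}" "block_prod p" "\<lambda>_. ?P" "(int p) ^ 3"] block_prod_cong[OF assms(1,2)]
    by simp
  have "[int ((p * a) choose (p * b)) * (?P ^ b * ?P ^ c) = int ((p * a) choose (p * b)) * (?Q b * ?Q c)] (mod (int p) ^ 3)"
    by (intro cong_scalar_left cong_mult cong_sym[OF Q])
  also have "int ((p * a) choose (p * b)) * (?Q b * ?Q c) = int (a choose b) * ?Q a"
    unfolding a using assms by (intro binomial_mult_block_prod) auto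
  also have "[\<dots> = int (a choose b) * ?P ^ a] (mod (int p) ^ 3)"
    by (intro cong_scalar_left Q)
  finally have "[int ((p * a) choose (p * b)) * ?P ^ a = int (a choose b) * ?P ^ a] (mod (int p) ^ 3)"
    by (simp add: a power_add)
  moreover have "coprime (?P ^ a) ((int p) ^ 3)"
    using coprime_block_prod[OF assms(1)] by simp
  ultimately show ?thesis by (simp add: cong_mult_rcancel)
qed

section \<open>Blocks and binomial coefficients modulo 27 for the prime 3\<close>

lemma block_prod_3: "block_prod 3 j = 2 + 9 * ((int j)\<^sup>2 + int j)"
  by (simp add: block_prod_def eval_nat_numeral algebra_simps)

lemma prod_block_prod_3_add_cong:
  "[(\<Prod>j<b+c. block_prod 3 j) = (\<Prod>j<b. block_prod 3 j) * (\<Prod>j<c. block_prod 3 j)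
      * (1 - 9 * (int b * int c * (int b + int c)))] (mod 27)"
proof (induction c)
  case (Suc c)
  let ?Q = "\<lambda>a. \<Prod>j<a. block_prod 3 j"
  \<comment> \<open>\<open>x\<close> is the increment of \<open>z\<close> when \<open>c\<close>
    grows by one. Moving from block \<open>c\<close> to block \<open>b + c\<close> adds
    \<open>9x\<close>; relative to a block congruent to 2 modulo 9 this is the factor
    \<open>1 - 9x\<close>, because \<open>-18\<close> is 9 modulo 27.\<close>
  define x where "x = (int b)\<^sup>2 + 2 * int b * int c + int b"
  define z where "z = int b * int c * (int b + int c)"
  have "[?Q (b + Suc c) = ?Q b * ?Q c * (1 - 9 * z) * block_prod 3 (b + c)] (mod 27)"
    using Suc unfolding z_def by (simp add: cong_scalar_right)
  also have "[?Q b * ?Q c * (1 - 9 * z) * block_prod 3 (b + c)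
      = ?Q b * ?Q c * (1 - 9 * z) * (block_prod 3 c * (1 - 9 * x))] (mod 27)"
  proof (intro cong_scalar_left)
    have "block_prod 3 (b + c) - block_prod 3 c * (1 - 9 * x) = 27 * (x + 3 * x * ((int c)\<^sup>2 + int c))"
      unfolding block_prod_3 x_def by (simp add: algebra_simps power2_eq_square)
    then show "[block_prod 3 (b + c) = block_prod 3 c * (1 - 9 * x)] (mod 27)"
      by (simp add: cong_iff_dvd_diff)
  qed
  also have "?Q b * ?Q c * (1 - 9 * z) * (block_prod 3 c * (1 - 9 * x))
      = ?Q b * ?Q (Suc c) * (1 - 9 * (z + x)) + 27 * (3 * x * z * (?Q b * ?Q (Suc c)))"
    by (simp add: algebra_simps)
  also have "[\<dots> = ?Q b * ?Q (Suc c) * (1 - 9 * (z + x))] (mod 27)"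
    by (simp add: cong_iff_dvd_diff)
  also have "z + x = int b * int (Suc c) * (int b + int (Suc c))"
    by (simp add: z_def x_def algebra_simps power2_eq_square)
  finally show ?case .
qed simp

lemma binomial_mult_3_cong:
  "[int ((3 * (b + c)) choose (3 * b))
     = int ((b + c) choose b) * (1 - 9 * (int b * int c * (int b + int c)))] (mod 27)"
proof -
  let ?Q = "\<lambda>a. \<Prod>j<a. block_prod 3 j"
  have "int ((3 * (b + c)) choose (3 * b)) * (?Q b * ?Q c) = int ((b + c) choose b) * ?Q (b + c)"
    by (rule binomial_mult_block_prod) simp
  also have "[\<dots> = int ((b + c) choose b) * (?Q b * ?Q c * (1 - 9 * (int b * int c * (int b + int c))))] (mod 27)"
    by (intro cong_scalar_left prod_block_prod_3_add_cong)
  finally have "[int ((3 * (b + c)) choose (3 * b)) * (?Q b * ?Q c)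
      = (int ((b + c) choose b) * (1 - 9 * (int b * int c * (int b + int c)))) * (?Q b * ?Q c)] (mod 27)"
    by (simp only: ac_simps)
  moreover have "coprime (?Q b * ?Q c) (3 ^ 3)"
  proof -
    have "coprime (?Q a) 3" for a
      using coprime_block_prod[of 3] by (intro prod_coprime_left) simp
    then show ?thesis by (simp only: coprime_mult_left_iff coprime_power_right_iff) simp
  qed
  ultimately show ?thesis by (simp add: cong_mult_rcancel)
qed

subsection \<open>Alternating power sums and Euler numbers\<close>

text \<open>With \<open>B\<close> the \<open>q\<close>-th Euler polynomial, this is \<open>2\<^sup>q B((x+1)/2)\<close>, rescaled to have integer
  coefficients.\<close>

definition euler_sum :: "nat \<Rightarrow> int \<Rightarrow> int" where
  "euler_sum q x = (\<Sum>k\<le>q. int (q choose k) * E k * x ^ (q - k))"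

text \<open>The defining relation of the Euler numbers, with the vanishing odd-index terms filled
  in.\<close>

lemma sum_binomial_E:
  assumes "even m" "m > 0"
  shows "(\<Sum>k\<le>m. int (m choose k) * E k) = 0"
proof -
  obtain i where i: "m = 2 * i" "i > 0" using assms by (auto elim!: evenE)
  have split: "(\<Sum>k\<le>2*i. f k) = (\<Sum>k\<le>i. f (2*k)) + (\<Sum>k<i. f (2*k+1))" for f :: "nat \<Rightarrow> int" and i
    by (induction i) auto
  have "(\<Sum>k\<le>m. int (m choose k) * E k) = (\<Sum>k\<le>i. int ((2 * i) choose (2 * k)) * euler_even k)"
    unfolding i(1) split by (simp add: E_def)
  also have "\<dots> = (\<Sum>k<i. int ((2 * i) choose (2 * k)) * euler_even k) + euler_even i"
    by (simp add: lessThan_Suc_atMost [symmetric])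
  also have "\<dots> = 0"
    using i(2) by (subst (2) euler_even.simps) simp
  finally show ?thesis .
qed

text \<open>The Appell property: the inner sum is \<open>euler_sum m s\<close>. Expand
  \<open>(x + s)^(q-k)\<close>, apply
  \<open>(q choose k)(q-k choose m-k) = (q choose m)(m choose k)\<close> and exchange the
  sums.\<close>

lemma euler_sum_add:
  "euler_sum q (x + s) = (\<Sum>m\<le>q. int (q choose m) * x ^ (q - m) * (\<Sum>k\<le>m. int (m choose k) * E k * s ^ (m - k)))"
proof -
  have "euler_sum q (x + s) = (\<Sum>k\<le>q. \<Sum>m | m \<in> {..q} \<and> k \<le> m.
          int (q choose m) * x ^ (q - m) * (int (m choose k) * E k * s ^ (m - k)))"
    unfolding euler_sum_def
  proof (rule sum.cong [OF refl])
    fix k assume k: "k \<in> {..q}"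
    have "(x + s) ^ (q - k) = (\<Sum>j\<le>q-k. int ((q - k) choose j) * s ^ j * x ^ (q - k - j))"
      using binomial_ring[of s x "q - k"] by (simp add: add.commute)
    also have "\<dots> = (\<Sum>m | m \<in> {..q} \<and> k \<le> m. int ((q - k) choose (m - k)) * s ^ (m - k) * x ^ (q - m))"
      using k by (intro sum.reindex_bij_witness[where i = "\<lambda>m. m - k" and j = "\<lambda>j. j + k"])
         (auto simp: add.commute)
    finally have "int (q choose k) * E k * (x + s) ^ (q - k)
       = (\<Sum>m | m \<in> {..q} \<and> k \<le> m. (int (q choose k) * int ((q - k) choose (m - k))) * E k * s ^ (m - k) * x ^ (q - m))"
      by (simp add: sum_distrib_left mult.assoc mult.left_commute)
    also have "\<dots> = (\<Sum>m | m \<in> {..q} \<and> k \<le> m.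
          int (q choose m) * x ^ (q - m) * (int (m choose k) * E k * s ^ (m - k)))"
    proof (rule sum.cong [OF refl])
      fix m assume "m \<in> {m. m \<in> {..q} \<and> k \<le> m}"
      then have "int (q choose k) * int ((q - k) choose (m - k)) = int (q choose m) * int (m choose k)"
        using choose_mult[of k m q] by (simp flip: of_nat_mult)
      then show "(int (q choose k) * int ((q - k) choose (m - k))) * E k * s ^ (m - k) * x ^ (q - m)
        = int (q choose m) * x ^ (q - m) * (int (m choose k) * E k * s ^ (m - k))"
        by (simp only: ac_simps)
    qed
    finally show "int (q choose k) * E k * (x + s) ^ (q - k) = \<dots>" .
  qed
  also have "\<dots> = (\<Sum>m\<le>q. \<Sum>k | k \<in> {..q} \<and> k \<le> m.
          int (q choose m) * x ^ (q - m) * (int (m choose k) * E k * s ^ (m - k)))"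
    by (rule sum.swap_restrict) auto
  also have "\<dots> = (\<Sum>m\<le>q. \<Sum>k\<le>m.
          int (q choose m) * x ^ (q - m) * (int (m choose k) * E k * s ^ (m - k)))"
    by (intro sum.cong refl) auto
  finally show ?thesis by (simp add: sum_distrib_left)
qed

text \<open>The functional equation of the Euler polynomials. Among the shifts by \<open>1\<close>
  and \<open>-1\<close>, odd \<open>m\<close> cancel because only even-index Euler numbers survive,
  and positive even \<open>m\<close> vanish by the defining relation.\<close>

lemma euler_sum_add_one_minus_one: "euler_sum q (x + 1) + euler_sum q (x - 1) = 2 * x ^ q"
proof -
  have inner: "(\<Sum>k\<le>m. int (m choose k) * E k * 1 ^ (m - k)) + (\<Sum>k\<le>m. int (m choose k) * E k * (-1) ^ (m - k))
     = (if m = 0 then 2 else 0)" for m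
  proof -
    have "(\<Sum>k\<le>m. int (m choose k) * E k * 1 ^ (m - k)) + (\<Sum>k\<le>m. int (m choose k) * E k * (-1) ^ (m - k))
       = (\<Sum>k\<le>m. (if even m then 2 else 0) * (int (m choose k) * E k))"
      unfolding sum.distrib [symmetric] by (rule sum.cong) (auto simp: E_def)
    also have "\<dots> = (if even m then 2 else 0) * (\<Sum>k\<le>m. int (m choose k) * E k)"
      by (simp add: sum_distrib_left)
    also have "\<dots> = (if m = 0 then 2 else 0)"
      using sum_binomial_E[of m] by (cases "m = 0") (auto simp: E_def)
    finally show ?thesis .
  qed
  have "euler_sum q (x + 1) + euler_sum q (x - 1) = euler_sum q (x + 1) + euler_sum q (x + (-1))"
    by simp
  also have "\<dots> = (\<Sum>m\<le>q. int (q choose m) * x ^ (q - m) * (if m = 0 then 2 else 0))"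
    unfolding euler_sum_add inner [symmetric] by (simp only: distrib_left sum.distrib)
  also have "\<dots> = (\<Sum>m\<le>q. if m = 0 then 2 * x ^ q else 0)"
    by (rule sum.cong) auto
  finally show ?thesis by simp
qed

text \<open>The functional equation at \<open>x = 2r\<close> makes the alternating sum
  telescope.\<close>

lemma alternating_power_sum_euler:
  assumes "even q" "q > 0"
  shows "2 * (\<Sum>r\<le>N. (-1) ^ r * (2 * int r) ^ q) = (-1) ^ N * euler_sum q (2 * int N + 1)"
proof (induction N)
  case 0
  \<comment> \<open>The lower end contributes nothing: \<open>euler_sum q\<close> vanishes at
    \<open>-1\<close>, hence by the functional equation at 0 also at 1.\<close>
  have "euler_sum q (-1) = (\<Sum>k\<le>q. int (q choose k) * E k)"
    unfolding euler_sum_def using assms(1) by (intro sum.cong) (auto simp: E_def)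
  then have "euler_sum q (-1) = 0" using sum_binomial_E[OF assms] by simp
  then show ?case using euler_sum_add_one_minus_one[of q 0] assms by simp
next
  case (Suc N)
  define z where "z = 2 * int (Suc N)"
  have z: "z - 1 = 2 * int N + 1" by (simp add: z_def)
  have "euler_sum q (z + 1) = 2 * z ^ q - euler_sum q (2 * int N + 1)"
    using euler_sum_add_one_minus_one[of q z] unfolding z by linarith
  moreover have "2 * (\<Sum>r\<le>Suc N. (-1) ^ r * (2 * int r) ^ q)
      = (-1) ^ N * euler_sum q (2 * int N + 1) - 2 * ((-1) ^ N * z ^ q)"
    unfolding Suc.IH [symmetric] z_def sum.atMost_Suc by (simp only: power_Suc) (simp only: distrib_left mult_minus_left mult_minus_right mult_1 ac_simps diff_conv_add_uminus)
  ultimately show ?case unfolding z_def [symmetric] by (simp add: right_diff_distrib)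
qed

text \<open>For \<open>N = (p-1)/2\<close> the argument \<open>2N + 1\<close> is \<open>p\<close>,
  so modulo \<open>p\<close> the Euler sum collapses to its constant term \<open>E (p - 3)\<close>.
  Multiplying by 4 removes the factor \<open>2^(p-3)\<close>.\<close>

lemma alternating_sum_power_prime_minus_3_cong:
  assumes "prime p" "p > 3"
  shows "[(\<Sum>r=1..(p-1) div 2. (-1) ^ r * int r ^ (p - 3)) = 2 * ((-1) ^ ((p-1) div 2) * E (p - 3))] (mod int p)"
proof -
  let ?q = "p - 3" and ?h = "(p - 1) div 2"
  let ?A = "\<Sum>r=1..?h. (-1) ^ r * int r ^ ?q"
  have op: "odd p" using assms by (simp add: prime_odd_nat)
  then have q: "even ?q" "?q > 0" using assms by auto
  have "{..?h} = insert 0 {1..?h}" by auto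
  then have A: "?A = (\<Sum>r\<le>?h. (-1) ^ r * int r ^ ?q)" using q(2) by simp
  have "2 * int ?h + 1 = int p" using op by (auto elim!: oddE)
  then have "2 * (\<Sum>r\<le>?h. (-1) ^ r * (2 * int r) ^ ?q) = (-1) ^ ?h * euler_sum ?q (int p)"
    using alternating_power_sum_euler[OF q, of ?h] by simp
  then have "4 * ((-1) ^ ?h * euler_sum ?q (int p)) = 4 * (2 * (2 ^ ?q * ?A))"
    unfolding A by (simp add: power_mult_distrib sum_distrib_left mult.left_commute)
  also have "\<dots> = ((int 2)\<^sup>2 * int 2 ^ ?q) * (2 * ?A)" by simp
  also have "[\<dots> = 1 * (2 * ?A)] (mod int p)"
    using assms op by (intro cong_scalar_right power2_times_power_prime_minus_3_cong) auto
  finally have 1: "[2 * ?A = 2 * (2 * ((-1) ^ ?h * euler_sum ?q (int p)))] (mod int p)"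
    by (simp add: cong_sym_eq)
  have "euler_sum ?q (int p) = E ?q + (\<Sum>k<?q. int (?q choose k) * E k * int p ^ (?q - k))"
    unfolding euler_sum_def by (simp add: lessThan_Suc_atMost [symmetric])
  moreover have "int p dvd (\<Sum>k<?q. int (?q choose k) * E k * int p ^ (?q - k))"
    by (intro dvd_sum) (auto intro!: dvd_mult dvd_power)
  ultimately have "[euler_sum ?q (int p) = E ?q] (mod int p)" by (simp add: cong_iff_dvd_diff)
  then have "[2 * (2 * ((-1) ^ ?h * euler_sum ?q (int p))) = 2 * (2 * ((-1) ^ ?h * E ?q))] (mod int p)"
    by (intro cong_scalar_left)
  with 1 have "[2 * ?A = 2 * (2 * ((-1) ^ ?h * E ?q))] (mod int p)" by (rule cong_trans)
  moreover have "coprime 2 (int p)" using op by simp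
  ultimately show ?thesis by (simp only: cong_mult_lcancel)
qed

subsection \<open>Reduction along multiples of a prime\<close>

lemma sum_atMost_mult:
  fixes f :: "nat \<Rightarrow> int"
  assumes "p > 0"
  shows "(\<Sum>k\<le>p*n. f k) = (\<Sum>j\<le>n. f (p*j)) + (\<Sum>j<n. \<Sum>r=1..<p. f (p*j+r))"
proof (induction n)
  case (Suc n)
  have "{..p * Suc n} = {..p * n} \<union> ({p * n + 1..<p * n + p} \<union> {p * Suc n})"
    using assms by auto
  then have "(\<Sum>k\<le>p*Suc n. f k) = (\<Sum>k\<le>p*n. f k) + ((\<Sum>k=p*n+1..<p*n+p. f k) + f (p * Suc n))"
    using assms by (simp only:) (subst sum.union_disjoint; auto)+
  also have "(\<Sum>k=p*n+1..<p*n+p. f k) = (\<Sum>r=1..<p. f (p*n+r))"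
    using sum.shift_bounds_nat_ivl[of f 1 "p * n" p] by (simp add: add.commute)
  finally show ?case unfolding Suc.IH by simp
qed simp

text \<open>Reflection at \<open>pn\<close> sends residue \<open>p - r\<close> in block
  \<open>j\<close> to residue \<open>r\<close> in block \<open>n - 1 - j\<close>, so the nonzero
  residues fold onto the lower half.\<close>

lemma S_mult_prime_decomp:
  assumes "odd p"
  shows "S (p * n) = (\<Sum>j\<le>n. S_term (p * n) (p * j))
     + 2 * (\<Sum>j<n. \<Sum>r=1..(p-1) div 2. S_term (p * n) (p * j + r))"
proof -
  let ?h = "(p - 1) div 2" and ?t = "S_term (p * n)"
  have h: "p = 2 * ?h + 1" using assms by (auto elim!: oddE)
  have split: "(\<Sum>r=1..<p. g r) = (\<Sum>r=1..?h. g r) + (\<Sum>r=1..?h. g (p - r))" for g :: "nat \<Rightarrow> int"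
  proof -
    have "{1..<p} = {1..?h} \<union> {Suc ?h..<p}" using h by auto
    then have "(\<Sum>r=1..<p. g r) = (\<Sum>r=1..?h. g r) + (\<Sum>r=Suc ?h..<p. g r)"
      by (simp only:) (subst sum.union_disjoint; auto)
    also have "(\<Sum>r=Suc ?h..<p. g r) = (\<Sum>r=1..?h. g (p - r))"
      by (rule sum.reindex_bij_witness[where i = "\<lambda>r. p - r" and j = "\<lambda>r. p - r"]) (use h in auto)
    finally show ?thesis .
  qed
  have swapped: "(\<Sum>j<n. ?t (p * j + (p - r))) = (\<Sum>j<n. ?t (p * j + r))" if r: "r \<in> {1..?h}" for r
  proof -
    have "(\<Sum>j<n. ?t (p * j + (p - r))) = (\<Sum>j<n. ?t (p * (n - Suc j) + r))"
    proof (rule sum.cong [OF refl])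
      fix j assume "j \<in> {..<n}"
      then obtain d where d: "n = Suc j + d" using less_iff_Suc_add by auto
      have "r \<le> p" using r h by auto
      then have "p * (n - Suc j) + r = p * n - (p * j + (p - r))" "p * j + (p - r) \<le> p * n"
        unfolding d by (auto simp: algebra_simps)
      then show "?t (p * j + (p - r)) = ?t (p * (n - Suc j) + r)"
        by (simp add: S_term_reflect)
    qed
    also have "\<dots> = (\<Sum>j<n. ?t (p * j + r))"
      by (rule sum.nat_diff_reindex)
    finally show ?thesis .
  qed
  have "(\<Sum>j<n. \<Sum>r=1..?h. ?t (p * j + (p - r))) = (\<Sum>r=1..?h. \<Sum>j<n. ?t (p * j + (p - r)))"
    by (rule sum.swap)
  also have "\<dots> = (\<Sum>r=1..?h. \<Sum>j<n. ?t (p * j + r))"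
    by (intro sum.cong [OF refl] swapped)
  also have "\<dots> = (\<Sum>j<n. \<Sum>r=1..?h. ?t (p * j + r))"
    by (rule sum.swap)
  finally have "(\<Sum>j<n. \<Sum>r=1..<p. ?t (p * j + r)) = 2 * (\<Sum>j<n. \<Sum>r=1..?h. ?t (p * j + r))"
    by (simp only: split sum.distrib mult_2)
  moreover have "p > 0" using assms by (auto intro: Nat.gr0I)
  ultimately show ?thesis
    by (simp only: S_eq_sum_S_term sum_atMost_mult)
qed

text \<open>The off-multiple summands factor into a sum over \<open>r\<close> and a reflected second
  moment. The constant 4 combines the 2 from folding with the 2 from the moment.\<close>

lemma S_mult_prime_cong:
  assumes "prime p" "odd p"
  shows "[S (p * n) = (\<Sum>j\<le>n. S_term (p * n) (p * j))
     + 4 * (int p)\<^sup>2 * (int n)\<^sup>2 * S (n - 1) * (\<Sum>r=1..(p-1) div 2. (-1) ^ r * int r ^ (p - 3))] (mod (int p) ^ 3)"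
proof -
  let ?h = "(p - 1) div 2"
  let ?A = "\<Sum>r=1..?h. (-1) ^ r * int r ^ (p - 3)"
  have "[(\<Sum>j<n. \<Sum>r=1..?h. S_term (p * n) (p * j + r))
      = (\<Sum>j<n. \<Sum>r=1..?h. (int p)\<^sup>2 * ((-1) ^ r * int r ^ (p - 3) * ((int (n - j))\<^sup>2 * S_term n j)))] (mod (int p) ^ 3)"
    by (intro cong_sum S_term_offset_cong assms) (use assms(2) in \<open>auto elim!: oddE\<close>)
  also have "(\<Sum>j<n. \<Sum>r=1..?h. (int p)\<^sup>2 * ((-1) ^ r * int r ^ (p - 3) * ((int (n - j))\<^sup>2 * S_term n j)))
      = (\<Sum>r=1..?h. (int p)\<^sup>2 * ((-1) ^ r * int r ^ (p - 3))) * (\<Sum>j<n. (int (n - j))\<^sup>2 * S_term n j)"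
    by (subst sum.swap) (simp only: sum_product mult.assoc)
  also have "(\<Sum>r=1..?h. (int p)\<^sup>2 * ((-1) ^ r * int r ^ (p - 3))) = (int p)\<^sup>2 * ?A"
    by (rule sum_distrib_left [symmetric])
  also have "(\<Sum>j<n. (int (n - j))\<^sup>2 * S_term n j) = (\<Sum>j\<le>n. (int (n - j))\<^sup>2 * S_term n j)"
    by (simp add: lessThan_Suc_atMost [symmetric])
  also have "\<dots> = 2 * (int n)\<^sup>2 * S (n - 1)"
    using sum_S_term_reflect[of "\<lambda>k. (int k)\<^sup>2" n] by (simp add: S_second_moment)
  finally have "[2 * (\<Sum>j<n. \<Sum>r=1..?h. S_term (p * n) (p * j + r))
      = 2 * ((int p)\<^sup>2 * ?A * (2 * (int n)\<^sup>2 * S (n - 1)))] (mod (int p) ^ 3)"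
    by (rule cong_scalar_left)
  then have "[(\<Sum>j\<le>n. S_term (p * n) (p * j)) + 2 * (\<Sum>j<n. \<Sum>r=1..?h. S_term (p * n) (p * j + r))
      = (\<Sum>j\<le>n. S_term (p * n) (p * j)) + 2 * ((int p)\<^sup>2 * ?A * (2 * (int n)\<^sup>2 * S (n - 1)))] (mod (int p) ^ 3)"
    by (intro cong_add cong_refl)
  moreover have "2 * ((int p)\<^sup>2 * ?A * (2 * (int n)\<^sup>2 * S (n - 1))) = 4 * (int p)\<^sup>2 * (int n)\<^sup>2 * S (n - 1) * ?A"
    by simp
  ultimately show ?thesis
    unfolding S_mult_prime_decomp[OF assms(2)] by (simp only:)
qed

text \<open>Doubling \<open>r\<close> carries into the next base-\<open>p\<close> digit and leaves
  the last digit \<open>2r - p\<close>, which is below \<open>r\<close>, so Lucas' theorem gives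
  zero.\<close>

lemma central_binomial_cong_0:
  assumes "prime p" "r < p" "p < 2 * r"
  shows "[int ((2 * (p * j + r)) choose (p * j + r)) = 0] (mod int p)"
proof -
  have eq: "2 * (p * j + r) = p * (2 * j + 1) + (2 * r - p)"
    using assms(3) by (simp add: algebra_simps)
  have "(2 * r - p) choose r = 0" using assms by (intro binomial_eq_0) linarith
  then show ?thesis
    using binomial_lucas_cong_int[OF assms(1) _ assms(2), of "2 * r - p" "2 * j + 1" j] assms(2)
    unfolding eq by (simp only: of_nat_0 mult_zero_right)
qed

text \<open>Only the middle residue \<open>r = h\<close> survives: larger \<open>r\<close> kill the
  central coefficient at \<open>k\<close>, smaller ones that at \<open>N - k\<close>. For
  \<open>r = h\<close> each of the three binomial coefficients contributes
  \<open>(-1)^h\<close>.\<close>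

lemma S_mult_prime_minus_1_cong:
  assumes "prime p" "odd p" "n > 0"
  shows "[S (p * n - 1) = (-1) ^ ((p - 1) div 2) * S (n - 1)] (mod int p)"
proof -
  define h where "h = (p - 1) div 2"
  have h: "p = 2 * h + 1" using assms(2) by (auto simp: h_def elim!: oddE)
  obtain m where m: "n = Suc m" using assms(3) gr0_conv_Suc by auto
  define N where "N = p * m + (p - 1)"
  have N: "p * n - 1 = N" "Suc N = p * Suc m" using h m by (auto simp: N_def)
  have "S N = (\<Sum>k<p * Suc m. S_term N k)"
    unfolding S_eq_sum_S_term lessThan_Suc_atMost [symmetric] N(2) ..
  also have "\<dots> = (\<Sum>j\<le>m. \<Sum>r<p. S_term N (p * j + r))"
  proof -
    have "(\<Sum>k=j*p..<j*p+p. S_term N k) = (\<Sum>r<p. S_term N (p * j + r))" for j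
      by (rule sum.reindex_bij_witness[where i = "\<lambda>r. p * j + r" and j = "\<lambda>k. k - p * j"])
         (auto simp: mult.commute)
    then show ?thesis
      using sum.nat_group[of "S_term N" p "Suc m"] unfolding lessThan_Suc_atMost
      by (simp only: mult.commute)
  qed
  also have "[\<dots> = (\<Sum>j\<le>m. \<Sum>r<p. if r = h then (-1) ^ h * S_term m j else 0)] (mod int p)"
  proof (intro cong_sum)
    fix j r assume jr: "j \<in> {..m}" "r \<in> {..<p}"
    let ?C = "\<lambda>m. int ((2 * m) choose m)"
    obtain d where d: "m = j + d" using jr le_Suc_ex by auto
    have diff: "N - (p * j + r) = p * d + (p - 1 - r)"
      using jr h by (simp add: N_def d algebra_simps)
    consider "r > h" | "r < h" | "r = h" by linarith
    then show "[S_term N (p * j + r) = (if r = h then (-1) ^ h * S_term m j else 0)] (mod int p)"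
    proof cases
      case 1
      have "[?C (p * j + r) = 0] (mod int p)"
        using jr 1 h by (intro central_binomial_cong_0 assms) auto
      then show ?thesis using 1 by (simp add: S_term_def cong_0_iff)
    next
      case 2
      have "[?C (p * d + (p - 1 - r)) = 0] (mod int p)"
        using jr 2 h by (intro central_binomial_cong_0 assms) auto
      then show ?thesis using 2 unfolding S_term_def diff by (simp add: cong_0_iff)
    next
      case 3
      have hp: "h < p" "2 * h = p - 1" "p - 1 - h = h" using h by auto
      have mid: "[int ((p - 1) choose h) = (-1) ^ h] (mod int p)"
        by (rule binomial_prime_minus_1_cong[OF assms(1) hp(1)])
      have 1: "[int (N choose (p * j + h)) = int (m choose j) * (-1) ^ h] (mod int p)"
        unfolding N_def using hp
        by (intro cong_trans[OF binomial_lucas_cong_int[OF assms(1)]] cong_scalar_left mid) auto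
      have 2: "[?C (p * i + h) = ?C i * (-1) ^ h] (mod int p)" for i
      proof -
        have "2 * (p * i + h) = p * (2 * i) + (p - 1)" using hp by (simp add: algebra_simps)
        then show ?thesis using hp
          by (simp only:) (intro cong_trans[OF binomial_lucas_cong_int[OF assms(1)]] cong_scalar_left mid; simp)
      qed
      have "[S_term N (p * j + h) = (int (m choose j) * (-1) ^ h) * (?C j * (-1) ^ h) * (?C d * (-1) ^ h)] (mod int p)"
        using diff unfolding S_term_def 3 hp by (simp only:) (intro cong_mult 1 2)
      also have "(int (m choose j) * (-1) ^ h) * (?C j * (-1) ^ h) * (?C d * (-1) ^ h)
          = ((-1) ^ h * (-1) ^ h) * ((-1) ^ h * S_term m j)"
        by (simp add: S_term_def d)
      also have "(-1) ^ h * (-1) ^ h = (1 :: int)" by (simp flip: power_add)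
      finally show ?thesis using 3 by simp
    qed
  qed
  also have "(\<Sum>j\<le>m. \<Sum>r<p. if r = h then (-1) ^ h * S_term m j else 0) = (-1) ^ h * S m"
  proof -
    have "h \<in> {..<p}" using h by simp
    then show ?thesis by (simp add: S_eq_sum_S_term sum_distrib_left del: lessThan_iff)
  qed
  finally show ?thesis unfolding N(1) h_def by (simp add: m)
qed

text \<open>In the recurrence at \<open>N = pn\<close>, \<open>4(3N^2 + 3N + 1)\<close> equals
  \<open>4(1+N)^3\<close> and \<open>32N^2\<close> equals \<open>32N^2(1+N)^2\<close> modulo
  \<open>N^3\<close>, so the unit \<open>(1+N)^2\<close> cancels.\<close>

lemma S_mult_prime_plus_1_cong:
  assumes "prime p"
  shows "[S (p * n + 1) = 4 * (1 + int p * int n) * S (p * n)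
     - 32 * (int p)\<^sup>2 * (int n)\<^sup>2 * S (p * n - 1)] (mod (int p) ^ 3)"
proof -
  define N where "N = int p * int n"
  let ?X = "4 * (1 + N) * S (p * n) - 32 * (int p)\<^sup>2 * (int n)\<^sup>2 * S (p * n - 1)"
  have dvd: "(int p) ^ 3 dvd N ^ 3" by (simp add: N_def power_mult_distrib)
  have "(1 + N)\<^sup>2 * S (p * n + 1) = 4 * (3 * N\<^sup>2 + 3 * N + 1) * S (p * n) - 32 * N\<^sup>2 * S (p * n - 1)"
    using S_recurrence[of "p * n"] by (simp add: N_def add.commute)
  then have "(1 + N)\<^sup>2 * S (p * n + 1) - (1 + N)\<^sup>2 * ?X
      = N ^ 3 * (32 * (2 + N) * S (p * n - 1) - 4 * S (p * n))"
    by (simp add: N_def algebra_simps power2_eq_square power3_eq_cube)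
  then have "[(1 + N)\<^sup>2 * S (p * n + 1) = (1 + N)\<^sup>2 * ?X] (mod (int p) ^ 3)"
    using dvd by (simp add: cong_iff_dvd_diff)
  moreover have "coprime ((1 + N)\<^sup>2) ((int p) ^ 3)"
  proof -
    have "[1 = 1 + N] (mod int p)" by (simp add: cong_iff_dvd_diff N_def)
    then have "coprime (1 + N) (int p)" by (rule cong_imp_coprime) simp
    then show ?thesis by simp
  qed
  ultimately show ?thesis unfolding N_def by (simp only: cong_mult_lcancel)
qed

subsection \<open>The values at multiples of a prime and their successors\<close>

lemma S_mult_prime_euler_cong:
  assumes "prime p" "p > 3"
  shows "[S (p * n) = S n + 8 * (int p)\<^sup>2 * (int n)\<^sup>2 * S (n - 1) * ((-1) ^ ((p - 1) div 2) * E (p - 3))]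
     (mod (int p) ^ 3)"
proof -
  let ?A = "\<Sum>r=1..(p-1) div 2. (-1) ^ r * int r ^ (p - 3)"
  let ?e = "(-1) ^ ((p - 1) div 2) * E (p - 3)"
  let ?m = "(int p) ^ 3"
  have op: "odd p" using assms by (simp add: prime_odd_nat)
  have "[(\<Sum>j\<le>n. S_term (p * n) (p * j)) = (\<Sum>j\<le>n. S_term n j)] (mod ?m)"
  proof (rule cong_sum)
    fix j assume "j \<in> {..n}"
    moreover have "2 * (p * j) = p * (2 * j)" "2 * (p * (n - j)) = p * (2 * (n - j))" by auto
    ultimately show "[S_term (p * n) (p * j) = S_term n j] (mod ?m)"
      unfolding S_term_def diff_mult_distrib2 [symmetric]
      by (simp only:) (intro cong_mult binomial_mult_prime_cong assms; simp)
  qed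
  moreover have "[4 * (int p)\<^sup>2 * (int n)\<^sup>2 * S (n - 1) * ?A = 8 * (int p)\<^sup>2 * (int n)\<^sup>2 * S (n - 1) * ?e] (mod ?m)"
  proof -
    have "[(int p)\<^sup>2 * ?A = (int p)\<^sup>2 * (2 * ?e)] (mod (int p)\<^sup>2 * int p)"
      by (intro cong_cmult_leftI alternating_sum_power_prime_minus_3_cong assms)
    moreover have "(int p)\<^sup>2 * int p = ?m" by (simp add: power2_eq_square power3_eq_cube)
    ultimately have "[(int p)\<^sup>2 * ?A = (int p)\<^sup>2 * (2 * ?e)] (mod ?m)" by (simp only:)
    then have "[4 * (int n)\<^sup>2 * S (n - 1) * ((int p)\<^sup>2 * ?A)
        = 4 * (int n)\<^sup>2 * S (n - 1) * ((int p)\<^sup>2 * (2 * ?e))] (mod ?m)"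
      by (rule cong_scalar_left)
    moreover have "4 * (int n)\<^sup>2 * S (n - 1) * ((int p)\<^sup>2 * ?A) = 4 * (int p)\<^sup>2 * (int n)\<^sup>2 * S (n - 1) * ?A"
      "4 * (int n)\<^sup>2 * S (n - 1) * ((int p)\<^sup>2 * (2 * ?e)) = 8 * (int p)\<^sup>2 * (int n)\<^sup>2 * S (n - 1) * ?e"
      by simp_all
    ultimately show ?thesis by (simp only:)
  qed
  ultimately show ?thesis
    unfolding S_eq_sum_S_term [of n]
    by (rule cong_trans [OF S_mult_prime_cong[OF assms(1) op] cong_add])
qed

lemma three_dvd_cube_minus_self: "3 dvd x ^ 3 - (x :: int)"
proof -
  define q where "q = x div 3"
  have "x mod 3 = 0 \<or> x mod 3 = 1 \<or> x mod 3 = 2" by presburger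
  then have "x = 3 * q \<or> x = 3 * q + 1 \<or> x = 3 * q + 2" unfolding q_def by presburger
  then show ?thesis
  proof (elim disjE)
    assume "x = 3 * q"
    then have "x ^ 3 - x = 3 * (9 * q ^ 3 - q)" by (simp add: power3_eq_cube)
    then show ?thesis by simp
  next
    assume "x = 3 * q + 1"
    then have "x ^ 3 - x = 3 * (9 * q ^ 3 + 9 * q\<^sup>2 + 2 * q)"
      by (simp add: power3_eq_cube power2_eq_square algebra_simps)
    then show ?thesis by simp
  next
    assume "x = 3 * q + 2"
    then have "x ^ 3 - x = 3 * (9 * q ^ 3 + 18 * q\<^sup>2 + 11 * q + 2)"
      by (simp add: power3_eq_cube power2_eq_square algebra_simps)
    then show ?thesis by simp
  qed
qed

text \<open>The corrections of the three binomial coefficients add up. Cubes reduce to first powers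
  modulo 3, leaving a quadratic weight in \<open>j\<close> that the first two moments
  evaluate.\<close>

lemma S_mult_3_cong:
  "[S (3 * n) = (1 - 18 * int n - 18 * (int n) ^ 3) * S n + (18 * (int n) ^ 3 - 36 * (int n)\<^sup>2) * S (n - 1)] (mod 27)"
proof -
  let ?x = "int n"
  define M where "M = (\<Sum>j\<le>n. int j * S_term n j)"
  have "[(\<Sum>j\<le>n. S_term (3 * n) (3 * j))
      = (\<Sum>j\<le>n. S_term n j * (1 - 9 * (?x\<^sup>2 * int j - ?x * (int j)\<^sup>2 + 2 * ?x)))] (mod 27)"
  proof (rule cong_sum)
    fix j assume "j \<in> {..n}"
    then obtain d where d: "n = j + d" using le_Suc_ex by auto
    let ?a = "int j * int d * (int j + int d)" and ?b = "int j * int j * (int j + int j)"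
      and ?c = "int d * int d * (int d + int d)"
    have t: "S_term (3 * n) (3 * j) = int ((3 * (j + d)) choose (3 * j)) * int ((3 * (j + j)) choose (3 * j))
        * int ((3 * (d + d)) choose (3 * d))"
      unfolding S_term_def diff_mult_distrib2 [symmetric] d by (simp add: mult_2)
    have "[S_term (3 * n) (3 * j) = int ((j + d) choose j) * (1 - 9 * ?a) * (int ((j + j) choose j) * (1 - 9 * ?b))
        * (int ((d + d) choose d) * (1 - 9 * ?c))] (mod 27)"
      unfolding t by (intro cong_mult binomial_mult_3_cong)
    also have "int ((j + d) choose j) * (1 - 9 * ?a) * (int ((j + j) choose j) * (1 - 9 * ?b))
        * (int ((d + d) choose d) * (1 - 9 * ?c))
        = S_term n j * ((1 - 9 * ?a) * (1 - 9 * ?b) * (1 - 9 * ?c))"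
    proof -
      have "S_term n j = int ((j + d) choose j) * int ((j + j) choose j) * int ((d + d) choose d)"
        unfolding S_term_def d by (simp add: mult_2)
      then show ?thesis by (simp only: mult.assoc mult.left_commute)
    qed
    also have "[\<dots> = S_term n j * (1 - 9 * (?x\<^sup>2 * int j - ?x * (int j)\<^sup>2 + 2 * ?x))] (mod 27)"
    proof (rule cong_scalar_left)
      obtain u where u: "int j ^ 3 - int j = 3 * u" using three_dvd_cube_minus_self[of "int j"] by (elim dvdE)
      obtain v where v: "int d ^ 3 - int d = 3 * v" using three_dvd_cube_minus_self[of "int d"] by (elim dvdE)
      have b: "?b = 2 * int j + 6 * u" using u by (simp add: algebra_simps power3_eq_cube)
      have c: "?c = 2 * int d + 6 * v" using v by (simp add: algebra_simps power3_eq_cube)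
      have a: "?x\<^sup>2 * int j - ?x * (int j)\<^sup>2 = ?a"
        unfolding d by (simp add: algebra_simps power2_eq_square)
      have "(1 - 9 * ?a) * (1 - 9 * ?b) * (1 - 9 * ?c) - (1 - 9 * (?a + 2 * ?x))
          = 27 * (3 * (?a * ?b + ?a * ?c + ?b * ?c) - 27 * (?a * ?b * ?c) - 2 * u - 2 * v)"
      proof -
        have "9 * (?a + 2 * ?x) = 9 * ?a + 9 * ?b + 9 * ?c - 54 * u - 54 * v"
          unfolding b c by (simp add: d)
        moreover have "(1 - 9 * A) * (1 - 9 * B) * (1 - 9 * C) - (1 - (9 * A + 9 * B + 9 * C - 54 * u - 54 * v))
           = 27 * (3 * (A * B + A * C + B * C) - 27 * (A * B * C) - 2 * u - 2 * v)" for A B C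
          by (simp add: algebra_simps)
        ultimately show ?thesis by (simp only:)
      qed
      then show "[(1 - 9 * ?a) * (1 - 9 * ?b) * (1 - 9 * ?c)
          = 1 - 9 * (?x\<^sup>2 * int j - ?x * (int j)\<^sup>2 + 2 * ?x)] (mod 27)"
        unfolding a cong_iff_dvd_diff by (simp only: dvd_triv_left)
    qed
    finally show "[S_term (3 * n) (3 * j)
      = S_term n j * (1 - 9 * (?x\<^sup>2 * int j - ?x * (int j)\<^sup>2 + 2 * ?x))] (mod 27)" .
  qed
  also have "(\<Sum>j\<le>n. S_term n j * (1 - 9 * (?x\<^sup>2 * int j - ?x * (int j)\<^sup>2 + 2 * ?x)))
      = (1 - 18 * ?x) * S n - 9 * ?x\<^sup>2 * M + 9 * ?x * (\<Sum>j\<le>n. (int j)\<^sup>2 * S_term n j)"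
    unfolding M_def S_eq_sum_S_term sum_distrib_left sum.distrib [symmetric] sum_subtractf [symmetric]
    by (rule sum.cong) (auto simp: algebra_simps)
  also have "\<dots> = (1 - 18 * ?x) * S n - 9 * ?x\<^sup>2 * M + 18 * ?x ^ 3 * S (n - 1)"
    unfolding S_second_moment by (simp add: power2_eq_square power3_eq_cube)
  also have "[\<dots> = (1 - 18 * ?x - 18 * ?x ^ 3) * S n + 18 * ?x ^ 3 * S (n - 1)] (mod 27)"
  proof -
    \<comment> \<open>Since 9 and 36 agree modulo 27, \<open>9 n^2 M\<close> may be read as
      \<open>36 n^2 M\<close>, which avoids halving the first moment.\<close>
    have "18 * ?x ^ 3 * S n = 18 * ?x\<^sup>2 * (?x * S n)" by (simp add: power2_eq_square power3_eq_cube)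
    also have "\<dots> = 36 * ?x\<^sup>2 * M"
      unfolding M_def S_first_moment [symmetric] by simp
    finally have "(1 - 18 * ?x) * S n - 9 * ?x\<^sup>2 * M + 18 * ?x ^ 3 * S (n - 1)
       - ((1 - 18 * ?x - 18 * ?x ^ 3) * S n + 18 * ?x ^ 3 * S (n - 1)) = 27 * (?x\<^sup>2 * M)"
      by (simp add: algebra_simps)
    then show ?thesis unfolding cong_iff_dvd_diff by (simp only: dvd_triv_left)
  qed
  finally have "[(\<Sum>j\<le>n. S_term (3 * n) (3 * j)) + - 36 * ?x\<^sup>2 * S (n - 1)
      = (1 - 18 * ?x - 18 * ?x ^ 3) * S n + 18 * ?x ^ 3 * S (n - 1) + - 36 * ?x\<^sup>2 * S (n - 1)] (mod 27)"
    by (intro cong_add cong_refl)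
  \<comment> \<open>For \<open>p = 3\<close> the sum over \<open>r\<close> is the single term
    \<open>-1\<close>, hence the coefficient \<open>-36\<close>.\<close>
  moreover have "[S (3 * n) = (\<Sum>j\<le>n. S_term (3 * n) (3 * j)) + - 36 * ?x\<^sup>2 * S (n - 1)] (mod 27)"
    using S_mult_prime_cong[of 3 n] by simp
  ultimately have "[S (3 * n)
      = (1 - 18 * ?x - 18 * ?x ^ 3) * S n + 18 * ?x ^ 3 * S (n - 1) + - 36 * ?x\<^sup>2 * S (n - 1)] (mod 27)"
    using cong_trans by blast
  then show ?thesis by (simp add: left_diff_distrib add_diff_eq)
qed

text \<open>Two consecutive instances of the recurrence modulo 3. It handles
  \<open>n = 3m + 2\<close>, the residue class where \<open>n^2 - n\<close> is not divisible by
  3.\<close>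

lemma three_dvd_S_add: "3 dvd S (3 * m + 2) + S (3 * m + 1)"
proof -
  let ?x = "int m"
  have "(3 * ?x + 1)\<^sup>2 * S (3 * m + 1) = 4 * (3 * (3 * ?x)\<^sup>2 + 3 * (3 * ?x) + 1) * S (3 * m)
       - 32 * (3 * ?x)\<^sup>2 * S (3 * m - 1)"
    using S_recurrence[of "3 * m"] by simp
  then have "S (3 * m + 1) - S (3 * m) = 3 * ((1 + 36 * ?x\<^sup>2 + 12 * ?x) * S (3 * m)
       - 96 * ?x\<^sup>2 * S (3 * m - 1) - (3 * ?x\<^sup>2 + 2 * ?x) * S (3 * m + 1))"
    by (simp add: algebra_simps power2_eq_square)
  then have 1: "3 dvd S (3 * m + 1) - S (3 * m)" by (simp only: dvd_triv_left)
  have "(3 * ?x + 2)\<^sup>2 * S (3 * m + 2) = 4 * (3 * (3 * ?x + 1)\<^sup>2 + 3 * (3 * ?x + 1) + 1) * S (3 * m + 1)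
       - 32 * (3 * ?x + 1)\<^sup>2 * S (3 * m)"
    using S_recurrence[of "3 * m + 1"] by (simp add: add.commute)
  then have eq: "S (3 * m + 2) + S (3 * m + 1) = 5 * (S (3 * m + 1) - S (3 * m))
      + 3 * (4 * ((3 * ?x + 1)\<^sup>2 + (3 * ?x + 1)) * S (3 * m + 1) - 9 * S (3 * m)
          - 32 * (3 * ?x\<^sup>2 + 2 * ?x) * S (3 * m) - (1 + 3 * ?x\<^sup>2 + 4 * ?x) * S (3 * m + 2))"
    by (simp add: algebra_simps power2_eq_square)
  show ?thesis unfolding eq by (intro dvd_add dvd_mult [OF 1] dvd_triv_left)
qed

lemma S_mult_3_plus_1_cong:
  assumes "n > 0"
  shows "[S (3 * n + 1) = (4 + 12 * int n - 9 * (int n)\<^sup>2) * S n] (mod 27)"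
proof -
  let ?x = "int n"
  let ?s = "S n" and ?s' = "S (n - 1)"
  let ?Y = "(1 - 18 * ?x - 18 * ?x ^ 3) * ?s + (18 * ?x ^ 3 - 36 * ?x\<^sup>2) * ?s'"
  have "[S (3 * n + 1) = 4 * (1 + 3 * ?x) * S (3 * n) - 32 * ?x\<^sup>2 * (9 * S (3 * n - 1))] (mod 27)"
    using S_mult_prime_plus_1_cong[of 3 n] by (simp add: mult_ac)
  also have "[4 * (1 + 3 * ?x) * S (3 * n) - 32 * ?x\<^sup>2 * (9 * S (3 * n - 1))
      = 4 * (1 + 3 * ?x) * ?Y - 32 * ?x\<^sup>2 * (9 * - ?s')] (mod 27)"
  proof -
    have "[S (3 * n - 1) = - ?s'] (mod 3)"
      using S_mult_prime_minus_1_cong[of 3 n] assms by simp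
    then have "[9 * S (3 * n - 1) = 9 * - ?s'] (mod (9 * 3))" by (rule cong_cmult_leftI)
    then have "[9 * S (3 * n - 1) = 9 * - ?s'] (mod 27)" by simp
    then have *: "[32 * ?x\<^sup>2 * (9 * S (3 * n - 1)) = 32 * ?x\<^sup>2 * (9 * - ?s')] (mod 27)"
      by (rule cong_scalar_left)
    show ?thesis by (rule cong_diff [OF cong_scalar_left [OF S_mult_3_cong] *])
  qed
  also have "[4 * (1 + 3 * ?x) * ?Y - 32 * ?x\<^sup>2 * (9 * - ?s') = (4 + 12 * ?x - 9 * ?x\<^sup>2) * ?s] (mod 27)"
  proof -
    \<comment> \<open>Once \<open>n^3\<close> is replaced by \<open>n\<close> modulo 3, nine times
      this product is all that separates the two sides modulo 27.\<close>
    have sum: "3 dvd (?x\<^sup>2 - ?x) * (?s + ?s')"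
    proof -
      consider m where "n = 3 * m" | m where "n = 3 * m + 1" | m where "n = 3 * m + 2"
      proof -
        have "n = 3 * (n div 3) \<or> n = 3 * (n div 3) + 1 \<or> n = 3 * (n div 3) + 2" by presburger
        then show ?thesis using that by blast
      qed
      then show ?thesis
      proof cases
        case 1
        then have "?x\<^sup>2 - ?x = 3 * (int m * (?x - 1))" by (simp add: power2_eq_square algebra_simps)
        then show ?thesis by simp
      next
        case 2
        then have "?x\<^sup>2 - ?x = 3 * (int m * ?x)" by (simp add: power2_eq_square algebra_simps)
        then show ?thesis by simp
      next
        case 3
        then show ?thesis using three_dvd_S_add[of m] by (simp add: dvd_mult)
      qed
    qed
    then obtain u where u: "(?x\<^sup>2 - ?x) * (?s + ?s') = 3 * u" by (elim dvdE)
    obtain v where v: "?x ^ 3 - ?x = 3 * v" using three_dvd_cube_minus_self[of ?x] by (elim dvdE)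
    have "4 * (1 + 3 * ?x) * ?Y - 32 * ?x\<^sup>2 * (9 * - ?s') - (4 + 12 * ?x - 9 * ?x\<^sup>2) * ?s
       = 9 * ((?x\<^sup>2 - ?x) * (?s + ?s') - 8 * (?x ^ 3 - ?x) * ?s - 40 * (?x ^ 3 - ?x) * ?s')
          + 27 * ((- 5 * ?x - 8 * ?x\<^sup>2 - 8 * ?x ^ 4) * ?s + (8 * ?x ^ 4 + 5 * ?x\<^sup>2 - 13 * ?x) * ?s')"
      by (simp add: power2_eq_square power3_eq_cube power4_eq_xxxx algebra_simps)
    also have "\<dots> = 27 * (u - 8 * v * ?s - 40 * v * ?s'
          + ((- 5 * ?x - 8 * ?x\<^sup>2 - 8 * ?x ^ 4) * ?s + (8 * ?x ^ 4 + 5 * ?x\<^sup>2 - 13 * ?x) * ?s'))"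
      unfolding u v by (simp add: distrib_left right_diff_distrib)
    finally show ?thesis unfolding cong_iff_dvd_diff by (simp only: dvd_triv_left)
  qed
  finally show ?thesis .
qed

text \<open>The Euler term, of coefficient \<open>4 * 8\<close>, and the recurrence term, of
  coefficient \<open>-32\<close>, share all other factors and merge into
  \<open>E (p - 3) - 1\<close>; the cross term with \<open>pn\<close> is a multiple of
  \<open>p^3\<close>.\<close>

lemma S_mult_prime_plus_1_euler_cong:
  assumes "prime p" "p > 3" "n > 0"
  shows "[S (p * n + 1) = 4 * int (p * n + 1) * S n
     + 32 * (int n)\<^sup>2 * S (n - 1) * (-1) ^ ((p - 1) div 2) * (E (p - 3) - 1) * (int p)\<^sup>2] (mod (int p) ^ 3)"
proof -
  let ?e = "(-1) ^ ((p - 1) div 2) :: int" and ?m = "(int p) ^ 3"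
  let ?x = "int n" and ?s' = "S (n - 1)" and ?E = "E (p - 3)"
  let ?Y = "S n + 8 * (int p)\<^sup>2 * ?x\<^sup>2 * ?s' * (?e * ?E)"
  have op: "odd p" using assms by (simp add: prime_odd_nat)
  have "[S (p * n + 1) = 4 * (1 + int p * ?x) * S (p * n) - 32 * (int p)\<^sup>2 * ?x\<^sup>2 * S (p * n - 1)] (mod ?m)"
    by (rule S_mult_prime_plus_1_cong[OF assms(1)])
  also have "32 * (int p)\<^sup>2 * ?x\<^sup>2 * S (p * n - 1) = 32 * ?x\<^sup>2 * ((int p)\<^sup>2 * S (p * n - 1))"
    by simp
  also have "[4 * (1 + int p * ?x) * S (p * n) - 32 * ?x\<^sup>2 * ((int p)\<^sup>2 * S (p * n - 1))
      = 4 * (1 + int p * ?x) * ?Y - 32 * ?x\<^sup>2 * ((int p)\<^sup>2 * (?e * ?s'))] (mod ?m)"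
  proof -
    have "[(int p)\<^sup>2 * S (p * n - 1) = (int p)\<^sup>2 * (?e * ?s')] (mod (int p)\<^sup>2 * int p)"
      by (intro cong_cmult_leftI S_mult_prime_minus_1_cong assms op)
    moreover have "(int p)\<^sup>2 * int p = ?m" by (simp add: power2_eq_square power3_eq_cube)
    ultimately have "[(int p)\<^sup>2 * S (p * n - 1) = (int p)\<^sup>2 * (?e * ?s')] (mod ?m)" by (simp only:)
    then have *: "[32 * ?x\<^sup>2 * ((int p)\<^sup>2 * S (p * n - 1)) = 32 * ?x\<^sup>2 * ((int p)\<^sup>2 * (?e * ?s'))] (mod ?m)"
      by (rule cong_scalar_left)
    show ?thesis
      by (intro cong_diff * cong_scalar_left [OF S_mult_prime_euler_cong] assms)
  qed
  also have "4 * (1 + int p * ?x) * ?Y - 32 * ?x\<^sup>2 * ((int p)\<^sup>2 * (?e * ?s'))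
      = 4 * int (p * n + 1) * S n + 32 * ?x\<^sup>2 * ?s' * ?e * (?E - 1) * (int p)\<^sup>2
        + ?m * (32 * ?x ^ 3 * ?s' * ?e * ?E)"
    by (simp add: power2_eq_square power3_eq_cube algebra_simps)
  also have "[\<dots> = 4 * int (p * n + 1) * S n + 32 * ?x\<^sup>2 * ?s' * ?e * (?E - 1) * (int p)\<^sup>2] (mod ?m)"
    by (simp add: cong_iff_dvd_diff)
  finally show ?thesis .
qed

theorem theorem3p4:
  fixes p n :: nat
  assumes "prime p" and "odd p" and "n > 0"
  shows "(p = 3 \<longrightarrow>
            [S (n*p+1) = (4 + 12 * int n - 9 * (int n)^2) * S n] (mod (int p)^3))
       \<and> (p > 3 \<longrightarrow>
            [S (n*p+1) = 4 * int (n*p+1) * S n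
                + 32 * (int n)^2 * S (n-1) * (-1)^((p-1) div 2) * (E (p-3) - 1) * (int p)^2]
              (mod (int p)^3))"
proof (intro conjI impI)
  assume "p = 3"
  then show "[S (n*p+1) = (4 + 12 * int n - 9 * (int n)^2) * S n] (mod (int p)^3)"
    using S_mult_3_plus_1_cong[OF assms(3)] by (simp add: mult.commute)
next
  assume "p > 3"
  then show "[S (n*p+1) = 4 * int (n*p+1) * S n
      + 32 * (int n)^2 * S (n-1) * (-1)^((p-1) div 2) * (E (p-3) - 1) * (int p)^2] (mod (int p)^3)"
    unfolding mult.commute [of n p]
    by (intro S_mult_prime_plus_1_euler_cong assms)
qed

end
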